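(* There exists a continuous linear operator $T$ on $\ell_1(\mathbb{N})$ such that $T$ is $UFHC_a$ for every $a\in\mathcal{A}$ and $T$ is not frequently hypercyclic.
   Context: For a sequence $a=(a_n)_{n\ge 0}$ of positive real numbers with $\sum_{n=0}^\infty a_n=\infty$ and a set $I$ of non-negative integers, define \[\overline{d_a}(I)=\limsup_{N\to\infty}\frac{\sum_{n\in[0,N]\cap I}a_n}{\sum_{n=0}^N a_n}.\] The unweighted lower density is $\underline{d}(I)=\liminf_{N\to\infty}\frac{|[0,N]\cap I|}{N+1}$. $\mathcal{A}$ denotes the set of all sequences $a=(a_n)_{n\ge0}$ of positive real numbers which are decreasing (in the wide sense, i.e. $a_{n+1}\le a_n$ for all $n$), tend to $0$, and satisfy $\sum_{n=0}^\infty a_n=\infty$. For a continuous linear operator $T$ on a separable infinite-dimensional Fréchet space $X$, $x\in X$ and $U\subset X$, put $N(x,U)=\{n\ge 0: T^nx\in U\}$. - $T$ is $UFHC_a$ ($\mathcal{U}$-frequently hypercyclic with respect to $a$) if there exists $x\in X$ such that $\overline{d_a}(N(x,U))>0$ for every non-empty open set $U\subset X$. (The vector $x$ may depend on $a$.) - $T$ is frequently hypercyclic if there exists $x\in X$ such that $\underline{d}(N(x,U))>0$ for every non-empty open set $U\subset X$. $\ell_1(\mathbb{N})$ is the Banach space of absolutely summable complex sequences indexed by $\mathbb{N}=\{0,1,2,\dots\}$. *)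

theory Defs
  imports "HOL-Analysis.Analysis"
begin

typedef ell1 = "{f :: nat \<Rightarrow> complex. summable (\<lambda>n. norm (f n))}"
  morphisms ell1_nth Abs_ell1
  by (rule exI[of _ "\<lambda>_. 0"]) simp

setup_lifting type_definition_ell1

lemma summable_ell1_nth: "summable (\<lambda>n. norm (ell1_nth x n))"
  using ell1_nth[of x] by simp

lemma ell1_eqI: "(\<And>n. ell1_nth x n = ell1_nth y n) \<Longrightarrow> x = y"
  by (simp add: ell1_nth_inject[symmetric] fun_eq_iff)

instantiation ell1 :: real_normed_vector
begin

lift_definition zero_ell1 :: ell1 is "\<lambda>_. 0"
  by simp

lift_definition plus_ell1 :: "ell1 \<Rightarrow> ell1 \<Rightarrow> ell1" is "\<lambda>f g n. f n + g n"
  subgoal for f g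
    by (rule summable_comparison_test'[of "\<lambda>n. norm (f n) + norm (g n)" 0])
       (auto intro: summable_add norm_triangle_ineq)
  done

lift_definition uminus_ell1 :: "ell1 \<Rightarrow> ell1" is "\<lambda>f n. - f n"
  by simp

definition minus_ell1 :: "ell1 \<Rightarrow> ell1 \<Rightarrow> ell1" where
  "x - y = x + (- y)" for x y :: ell1

lift_definition scaleR_ell1 :: "real \<Rightarrow> ell1 \<Rightarrow> ell1" is "\<lambda>r f n. r *\<^sub>R f n"
  by (simp add: summable_mult)

lift_definition norm_ell1 :: "ell1 \<Rightarrow> real" is "\<lambda>f. \<Sum>n. norm (f n)" .

definition sgn_ell1 :: "ell1 \<Rightarrow> ell1" where
  "sgn_ell1 x = inverse (norm x) *\<^sub>R x"

definition dist_ell1 :: "ell1 \<Rightarrow> ell1 \<Rightarrow> real" where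
  "dist_ell1 x y = norm (x - y)"

definition uniformity_ell1 :: "(ell1 \<times> ell1) filter" where
  "uniformity_ell1 = (INF e\<in>{0 <..}. principal {(x, y). dist x y < e})"

definition open_ell1 :: "ell1 set \<Rightarrow> bool" where
  "open_ell1 S = (\<forall>x\<in>S. \<forall>\<^sub>F (x', y) in uniformity. x' = x \<longrightarrow> y \<in> S)"

instance
proof
  fix x y z :: ell1 and r s :: real
  show "x + y + z = x + (y + z)" by transfer (simp add: algebra_simps)
  show "x + y = y + x" by transfer (simp add: algebra_simps)
  show "0 + x = x" by transfer simp
  show "- x + x = 0" by transfer simp
  show "x - y = x + - y" by (simp add: minus_ell1_def)
  show "r *\<^sub>R (x + y) = r *\<^sub>R x + r *\<^sub>R y" by transfer (simp add: algebra_simps)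
  show "(r + s) *\<^sub>R x = r *\<^sub>R x + s *\<^sub>R x" by transfer (simp add: algebra_simps)
  show "r *\<^sub>R s *\<^sub>R x = (r * s) *\<^sub>R x" by transfer simp
  show "1 *\<^sub>R x = x" by transfer simp
  show "norm x = 0 \<longleftrightarrow> x = 0"
    by transfer (auto simp: suminf_eq_zero_iff fun_eq_iff)
  show "norm (x + y) \<le> norm x + norm y"
  proof (transfer, goal_cases)
    case (1 f g)
    then have sum: "summable (\<lambda>n. norm (f n) + norm (g n))" by (simp add: summable_add)
    moreover have "summable (\<lambda>n. norm (f n + g n))"
      by (rule summable_comparison_test'[OF sum, of 0]) (simp add: norm_triangle_ineq)
    ultimately have "(\<Sum>n. norm (f n + g n)) \<le> (\<Sum>n. norm (f n) + norm (g n))"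
      by (intro suminf_le norm_triangle_ineq)
    with 1 show ?case by (simp add: suminf_add [symmetric])
  qed
  show "norm (r *\<^sub>R x) = \<bar>r\<bar> * norm x"
    by transfer (simp add: suminf_mult)
qed (rule sgn_ell1_def dist_ell1_def uniformity_ell1_def open_ell1_def)+

end

lemma ell1_nth_zero [simp]: "ell1_nth 0 n = 0"
  by transfer simp

lemma ell1_nth_add [simp]: "ell1_nth (x + y) n = ell1_nth x n + ell1_nth y n"
  by transfer simp

lemma ell1_nth_uminus [simp]: "ell1_nth (- x) n = - ell1_nth x n"
  by transfer simp

lemma ell1_nth_diff [simp]: "ell1_nth (x - y) n = ell1_nth x n - ell1_nth y n"
  by (simp only: minus_ell1_def ell1_nth_add ell1_nth_uminus diff_conv_add_uminus)

lemma norm_ell1_eq: "norm x = (\<Sum>n. norm (ell1_nth x n))"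
  by transfer simp

lemma sum_norm_le_norm_ell1: "(\<Sum>n<k. norm (ell1_nth x n)) \<le> norm x"
  unfolding norm_ell1_eq by (rule sum_le_suminf) (auto simp: summable_ell1_nth)

lemma norm_ell1_nth_le: "norm (ell1_nth x n) \<le> norm x"
  using sum_norm_le_norm_ell1[of x "Suc n"] sum_nonneg[of "{..<n}" "\<lambda>n. norm (ell1_nth x n)"]
  by simp

instance ell1 :: banach
proof
  fix X :: "nat \<Rightarrow> ell1"
  assume X: "Cauchy X"
  have "Cauchy (\<lambda>m. ell1_nth (X m) n)" for n
  proof (rule metric_CauchyI)
    fix e :: real assume "e > 0"
    then obtain M where M: "\<And>m k. m \<ge> M \<Longrightarrow> k \<ge> M \<Longrightarrow> norm (X m - X k) < e"
      using metric_CauchyD[OF X] unfolding dist_norm by meson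
    have "dist (ell1_nth (X m) n) (ell1_nth (X k) n) < e" if "m \<ge> M" "k \<ge> M" for m k
      using norm_ell1_nth_le[of "X m - X k" n] M[OF that] by (simp add: dist_norm)
    then show "\<exists>M. \<forall>m\<ge>M. \<forall>k\<ge>M. dist (ell1_nth (X m) n) (ell1_nth (X k) n) < e" by blast
  qed
  then have "\<forall>n. \<exists>l. (\<lambda>m. ell1_nth (X m) n) \<longlonglongrightarrow> l"
    using Cauchy_convergent convergent_def by blast
  then obtain f where f: "\<And>n. (\<lambda>m. ell1_nth (X m) n) \<longlonglongrightarrow> f n"
    by metis
  have bound: "\<exists>M. \<forall>m\<ge>M. \<forall>k. (\<Sum>n<k. norm (ell1_nth (X m) n - f n)) \<le> e" if "e > 0" for e
  proof -
    obtain M where M: "\<And>m k. m \<ge> M \<Longrightarrow> k \<ge> M \<Longrightarrow> norm (X m - X k) < e"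
      using metric_CauchyD[OF X \<open>e > 0\<close>] unfolding dist_norm by meson
    have "(\<Sum>n<k. norm (ell1_nth (X m) n - f n)) \<le> e" if "m \<ge> M" for m k
    proof (rule LIMSEQ_le_const2)
      show "(\<lambda>j. \<Sum>n<k. norm (ell1_nth (X m) n - ell1_nth (X j) n))
              \<longlonglongrightarrow> (\<Sum>n<k. norm (ell1_nth (X m) n - f n))"
        by (intro tendsto_intros f)
      have "(\<Sum>n<k. norm (ell1_nth (X m) n - ell1_nth (X j) n)) \<le> e" if "j \<ge> M" for j
        using sum_norm_le_norm_ell1[of "X m - X j" k] M[OF \<open>m \<ge> M\<close> that] by simp
      then show "\<exists>N. \<forall>j\<ge>N. (\<Sum>n<k. norm (ell1_nth (X m) n - ell1_nth (X j) n)) \<le> e" by blast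
    qed
    then show ?thesis by blast
  qed
  have diff: "summable (\<lambda>n. norm (ell1_nth (X m) n - f n))"
    if "\<forall>k. (\<Sum>n<k. norm (ell1_nth (X m) n - f n)) \<le> e" for m e
    using that by (intro summableI_nonneg_bounded[of _ e]) auto
  obtain M where "\<forall>k. (\<Sum>n<k. norm (ell1_nth (X M) n - f n)) \<le> 1"
    using bound[of 1] by auto
  from diff[OF this] have "summable (\<lambda>n. norm (ell1_nth (X M) n) + norm (ell1_nth (X M) n - f n))"
    by (intro summable_add summable_ell1_nth)
  then have "summable (\<lambda>n. norm (f n))"
  proof (rule summable_comparison_test'[where N = 0])
    fix n
    show "norm (norm (f n)) \<le> norm (ell1_nth (X M) n) + norm (ell1_nth (X M) n - f n)"
      using norm_triangle_ineq4[of "ell1_nth (X M) n" "ell1_nth (X M) n - f n"] by simp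
  qed
  then have nth: "ell1_nth (Abs_ell1 f) = f" by (simp add: Abs_ell1_inverse)
  have "X \<longlonglongrightarrow> Abs_ell1 f"
  proof (rule metric_LIMSEQ_I)
    fix e :: real assume "e > 0"
    then obtain M where M: "\<forall>m\<ge>M. \<forall>k. (\<Sum>n<k. norm (ell1_nth (X m) n - f n)) \<le> e / 2"
      using bound[of "e / 2"] by auto
    have "dist (X m) (Abs_ell1 f) < e" if "m \<ge> M" for m
    proof -
      have le: "\<forall>k. (\<Sum>n<k. norm (ell1_nth (X m) n - f n)) \<le> e / 2"
        using M that by blast
      have "(\<Sum>n. norm (ell1_nth (X m) n - f n)) \<le> e / 2"
        by (rule suminf_le_const[OF diff[OF le]]) (use le in simp)
      with \<open>e > 0\<close> show ?thesis by (simp add: dist_norm norm_ell1_eq nth)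
    qed
    then show "\<exists>M. \<forall>m\<ge>M. dist (X m) (Abs_ell1 f) < e" by blast
  qed
  then show "convergent X" by (rule convergentI)
qed

text \<open>The type class only provides real scalars; this is the complex vector space structure.\<close>

lift_definition scaleC_ell1 :: "complex \<Rightarrow> ell1 \<Rightarrow> ell1" is "\<lambda>c f n. c * f n"
  by (simp add: norm_mult summable_mult)

lemma ell1_nth_scaleC [simp]: "ell1_nth (scaleC_ell1 c x) n = c * ell1_nth x n"
  by transfer simp

interpretation ell1: vector_space scaleC_ell1
  by unfold_locales (transfer; simp add: algebra_simps)+

lemma norm_scaleC_ell1: "norm (scaleC_ell1 c x) = norm c * norm x"
  unfolding norm_ell1_eq ell1_nth_scaleC norm_mult by (rule suminf_mult[OF summable_ell1_nth])

definition upper_density_wrt :: "(nat \<Rightarrow> real) \<Rightarrow> nat set \<Rightarrow> ereal" where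
  "upper_density_wrt a I =
     limsup (\<lambda>N. ereal ((\<Sum>n\<in>{0..N} \<inter> I. a n) / (\<Sum>n=0..N. a n)))"

definition lower_density :: "nat set \<Rightarrow> ereal" where
  "lower_density I = liminf (\<lambda>N. ereal (real (card ({0..N} \<inter> I)) / real (N + 1)))"

definition weight_seqs :: "(nat \<Rightarrow> real) set" where
  "weight_seqs = {a. (\<forall>n. a n > 0) \<and> decseq a \<and> a \<longlonglongrightarrow> 0 \<and>
                     filterlim (\<lambda>N. \<Sum>n=0..N. a n) at_top sequentially}"

definition return_times :: "('a \<Rightarrow> 'a) \<Rightarrow> 'a \<Rightarrow> 'a set \<Rightarrow> nat set" where
  "return_times T x U = {n. (T ^^ n) x \<in> U}"

definition U_frequently_hypercyclic_wrt ::
    "(nat \<Rightarrow> real) \<Rightarrow> ('a::topological_space \<Rightarrow> 'a) \<Rightarrow> bool" where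
  "U_frequently_hypercyclic_wrt a T \<longleftrightarrow>
     (\<exists>x. \<forall>U. open U \<and> U \<noteq> {} \<longrightarrow> upper_density_wrt a (return_times T x U) > 0)"

definition frequently_hypercyclic :: "('a::topological_space \<Rightarrow> 'a) \<Rightarrow> bool" where
  "frequently_hypercyclic T \<longleftrightarrow>
     (\<exists>x. \<forall>U. open U \<and> U \<noteq> {} \<longrightarrow> lower_density (return_times T x U) > 0)"

end

theory Submission
  imports Defs
begin

text \<open>
  Two soft properties of an operator on a separable Banach space suffice to be
  \<open>\<U>\<close>-frequently hypercyclic with respect to every decreasing weight sequence with divergent sum:
  the periodic vectors are dense, and so are the vectors that are annihilated by some power of the
  operator. Near every vector there is then the sum of a given periodic vector and an annihilated one,
  and the orbit of this sum is eventually periodic. How often it visits a given open set depends only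
  on the period, and Baire's theorem applies
  (\<open>U_frequently_hypercyclic_wrt_if_dense_periodic_dense_nilpotent\<close>).

  The operator that has these two properties without being frequently hypercyclic lives on blocks of
  coordinates, the \<open>n\<close>-th of length \<open>8 ^ n\<close>. It moves the rescaled unit vectors
  \<open>basis_vec k\<close> one step forward inside a block. One lap after the start of block \<open>n\<close>, it maps the
  first vector \<open>F\<close> of the block and a finitely supported vector \<open>v n\<close> from the earlier blocks in such
  a way that the difference \<open>F - v n\<close> becomes \<open>lam n\<close> times itself, with \<open>lam n\<close> equal to \<open>0\<close> or
  \<open>1\<close>. The norm of \<open>F\<close> is \<open>1 / 2 ^ n\<close>, and the vectors \<open>v n\<close> exhaust all directions, so the multiples
  of the vectors \<open>F - v n\<close> with \<open>lam n = 1\<close> are dense and periodic, and those with \<open>lam n = 0\<close>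
  are dense and annihilated.

  The weights double at the beginning of each block and then stay on a very high plateau until its end.
  All coefficients with respect to the vectors \<open>basis_vec k\<close> stay bounded by \<open>1\<close> along the orbits of
  these vectors (\<open>coordinate_le\<close>). Therefore a hypercyclic vector needs non-summable coefficients,
  and these can only sit in the first \<open>n\<close> positions of the blocks \<open>n\<close>, the only positions with small
  weights. From there they climb to the plateau after a time that is quadratic in \<open>n\<close>
  and stay on it for the rest of the lap, so that the orbit is far from the origin during most of the
  first \<open>8 ^ n\<close> steps (\<open>norm_funpow_ge\<close>, \<open>not_frequently_hypercyclic\<close>). The annihilated vectors
  above make one such excursion, too. It spoils a lower density when this happens for infinitely many
  \<open>n\<close>, but an upper density can wait until it is over.
\<close>

section \<open>Operators on the sequence space given by their columns\<close>

lemma ell1_nth_scaleR [simp]: "ell1_nth (r *\<^sub>R x) n = r *\<^sub>R ell1_nth x n"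
  by transfer simp

lemma ell1_nth_sum: "ell1_nth (\<Sum>i\<in>A. f i) n = (\<Sum>i\<in>A. ell1_nth (f i) n)"
  by (induction A rule: infinite_finite_induct) simp_all

definition unit_ell1 :: "nat \<Rightarrow> ell1" where
  "unit_ell1 k = Abs_ell1 (\<lambda>i. if i = k then 1 else 0)"

lemma ell1_nth_unit [simp]: "ell1_nth (unit_ell1 k) i = (if i = k then 1 else 0)"
proof -
  have "summable (\<lambda>i. norm (if i = k then 1 else 0 :: complex))"
    by (rule summable_finite[of "{k}"]) auto
  then show ?thesis
    by (simp add: unit_ell1_def Abs_ell1_inverse)
qed

lemma norm_unit_ell1 [simp]: "norm (unit_ell1 k) = 1"
proof -
  have "(\<lambda>i. norm (ell1_nth (unit_ell1 k) i)) sums (\<Sum>i\<in>{k}. norm (ell1_nth (unit_ell1 k) i))"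
    by (rule sums_finite) auto
  then show ?thesis
    by (simp add: norm_ell1_eq sums_iff)
qed

lemma ell1_expansion: "(\<lambda>k. scaleC_ell1 (ell1_nth x k) (unit_ell1 k)) sums x"
proof -
  let ?P = "\<lambda>N. \<Sum>k<N. scaleC_ell1 (ell1_nth x k) (unit_ell1 k)"
  have nth: "ell1_nth (?P N) i = (if i < N then ell1_nth x i else 0)" for N i
    by (simp add: ell1_nth_sum if_distrib[of "\<lambda>c. _ * c"] cong: if_cong)
  have "norm (?P N - x) = norm x - (\<Sum>i<N. norm (ell1_nth x i))" for N
  proof -
    have "(\<lambda>i. norm (ell1_nth x i) - (if i \<in> {..<N} then norm (ell1_nth x i) else 0)) sums
        ((\<Sum>i. norm (ell1_nth x i)) - (\<Sum>i<N. norm (ell1_nth x i)))"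
      by (intro sums_diff summable_sums summable_ell1_nth sums_If_finite_set) simp
    moreover have "(\<lambda>i. norm (ell1_nth x i) - (if i \<in> {..<N} then norm (ell1_nth x i) else 0))
        = (\<lambda>i. norm (ell1_nth (?P N - x) i))"
      by (auto simp: nth fun_eq_iff)
    ultimately show ?thesis
      unfolding norm_ell1_eq by (simp add: sums_iff)
  qed
  moreover have "(\<lambda>N. norm x - (\<Sum>i<N. norm (ell1_nth x i))) \<longlonglongrightarrow> norm x - norm x"
    unfolding norm_ell1_eq
    by (intro tendsto_diff tendsto_const summable_LIMSEQ summable_ell1_nth)
  ultimately have "(\<lambda>N. norm (?P N - x)) \<longlonglongrightarrow> 0"
    by simp
  then show ?thesis
    unfolding sums_def by (simp add: LIM_zero_iff tendsto_norm_zero_iff)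
qed

lemma bounded_linear_ell1_nth: "bounded_linear (\<lambda>x. ell1_nth x k)"
  by (rule bounded_linear_intro[of _ 1]) (auto simp: norm_ell1_nth_le)

lemma bounded_linear_scaleC: "bounded_linear (scaleC_ell1 c)"
proof (rule bounded_linear_intro[of _ "norm c"])
  show "scaleC_ell1 c (r *\<^sub>R x) = r *\<^sub>R scaleC_ell1 c x" for r x
    by (rule ell1_eqI) simp
qed (simp_all add: ell1.scale_right_distrib norm_scaleC_ell1 mult.commute)

lemma scaleR_eq_scaleC: "r *\<^sub>R x = scaleC_ell1 (of_real r) x"
  by (rule ell1_eqI) (simp add: scaleR_conv_of_real)

text \<open>By the expansion in unit vectors, a complex-linear functional is controlled by its values on
  those unit vectors that actually occur in the argument. Applied to the functionals
  \<open>y \<mapsto> ell1_nth ((T ^^ j) y) i\<close>, this reduces every estimate on orbits to estimates on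
  orbits of unit vectors.\<close>

lemma norm_functional_le:
  fixes h :: "ell1 \<Rightarrow> complex"
  assumes "bounded_linear h" and hC: "\<And>c x. h (scaleC_ell1 c x) = c * h x"
    and d: "\<And>k. ell1_nth x k \<noteq> 0 \<Longrightarrow> norm (h (unit_ell1 k)) \<le> d k"
    and sm: "summable (\<lambda>k. norm (ell1_nth x k) * d k)"
  shows "norm (h x) \<le> (\<Sum>k. norm (ell1_nth x k) * d k)"
proof -
  have le: "norm (ell1_nth x k * h (unit_ell1 k)) \<le> norm (ell1_nth x k) * d k" for k
    using d[of k] by (cases "ell1_nth x k = 0") (auto simp: norm_mult intro: mult_left_mono)
  have sn: "summable (\<lambda>k. norm (ell1_nth x k * h (unit_ell1 k)))"
    by (rule summable_comparison_test'[OF sm, of 0]) (use le in simp)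
  have "(\<lambda>k. h (scaleC_ell1 (ell1_nth x k) (unit_ell1 k))) sums h x"
    by (rule bounded_linear.sums[OF assms(1) ell1_expansion])
  then have "norm (h x) = norm (\<Sum>k. ell1_nth x k * h (unit_ell1 k))"
    by (simp add: hC sums_iff)
  also have "\<dots> \<le> (\<Sum>k. norm (ell1_nth x k * h (unit_ell1 k)))"
    by (rule summable_norm[OF sn])
  also have "\<dots> \<le> (\<Sum>k. norm (ell1_nth x k) * d k)"
    by (rule suminf_le[OF le sn sm])
  finally show ?thesis .
qed

definition column_operator :: "(nat \<Rightarrow> ell1) \<Rightarrow> ell1 \<Rightarrow> ell1" where
  "column_operator c x = (\<Sum>k. scaleC_ell1 (ell1_nth x k) (c k))"

lemma column_operator_unit: "column_operator c (unit_ell1 k) = c k"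
proof -
  have "(\<lambda>i. scaleC_ell1 (ell1_nth (unit_ell1 k) i) (c i)) sums
      (\<Sum>i\<in>{k}. scaleC_ell1 (ell1_nth (unit_ell1 k) i) (c i))"
    by (rule sums_finite) auto
  then show ?thesis
    by (simp add: column_operator_def sums_iff)
qed

lemma column_operator_cong:
  "(\<And>k. ell1_nth x k \<noteq> 0 \<Longrightarrow> c k = c' k) \<Longrightarrow> column_operator c x = column_operator c' x"
  unfolding column_operator_def
  by (rule arg_cong[where f = suminf], rule ext) (metis ell1.scale_zero_left)

context
  fixes c :: "nat \<Rightarrow> ell1" and C :: real
  assumes C: "\<And>k. norm (c k) \<le> C"
begin

lemma summable_norm_columns: "summable (\<lambda>k. norm (scaleC_ell1 (ell1_nth x k) (c k)))"
  by (rule summable_comparison_test'[OF summable_mult2[OF summable_ell1_nth[of x], of C], of 0])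
     (simp add: norm_scaleC_ell1 C mult_left_mono)

lemma summable_columns: "summable (\<lambda>k. scaleC_ell1 (ell1_nth x k) (c k))"
  by (rule summable_norm_cancel[OF summable_norm_columns])

lemma column_operator_scaleC:
  "column_operator c (scaleC_ell1 a x) = scaleC_ell1 a (column_operator c x)"
  unfolding column_operator_def
  using bounded_linear.suminf[OF bounded_linear_scaleC summable_columns[of x], of a] by simp

lemma bounded_linear_column_operator: "bounded_linear (column_operator c)"
proof (rule bounded_linear_intro[of _ C])
  fix x y :: ell1 and r :: real
  show "column_operator c (x + y) = column_operator c x + column_operator c y"
    unfolding column_operator_def
    by (simp add: suminf_add[OF summable_columns summable_columns] ell1.scale_left_distrib)
  show "column_operator c (r *\<^sub>R x) = r *\<^sub>R column_operator c x"
    by (simp add: scaleR_eq_scaleC column_operator_scaleC)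
  have "norm (column_operator c x) \<le> (\<Sum>k. norm (scaleC_ell1 (ell1_nth x k) (c k)))"
    unfolding column_operator_def by (rule summable_norm[OF summable_norm_columns])
  also have "\<dots> \<le> (\<Sum>k. norm (ell1_nth x k) * C)"
    by (intro suminf_le summable_norm_columns summable_mult2 summable_ell1_nth)
       (simp add: norm_scaleC_ell1 C mult_left_mono)
  also have "\<dots> = norm x * C"
    unfolding norm_ell1_eq by (rule suminf_mult2[symmetric, OF summable_ell1_nth])
  finally show "norm (column_operator c x) \<le> norm x * C" .
qed

end

section \<open>Dense periodic and dense annihilated vectors\<close>

lemma Baire_complete:
  fixes \<G> :: "'a::complete_space set set"
  assumes "countable \<G>" and "\<And>S. S \<in> \<G> \<Longrightarrow> open S" and "\<And>S. S \<in> \<G> \<Longrightarrow> closure S = UNIV"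
  shows "closure (\<Inter>\<G>) = UNIV"
proof -
  have "Met_TC.mcomplete TYPE('a)"
    by (simp add: complete_UNIV)
  then have "euclidean closure_of \<Inter>\<G> = (UNIV :: 'a set)"
    using Met_TC.metric_Baire_category[of \<G>] assms by simp
  then show ?thesis
    by simp
qed

text \<open>Since the weights decrease, \<open>a m\<close> at a multiple \<open>m\<close> of \<open>R\<close> is at least the average of \<open>a\<close>
  over \<open>{m..<m + R}\<close>, so the multiples of \<open>R\<close> carry at least a fraction \<open>1 / R\<close> of the
  total weight up to a bounded error; the divergence of the sum of the weights absorbs the error
  at the price of a factor \<open>2\<close>. The resulting density does not depend on \<open>a\<close>.\<close>

lemma eventually_weighted_multiples_ge:
  assumes a: "a \<in> weight_seqs" and "R > 0"
  shows "\<forall>\<^sub>F N in sequentially.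
    (\<Sum>n=0..N. a n) / (2 * real R) < (\<Sum>n | n \<le> N \<and> J \<le> n \<and> R dvd n. a n)"
proof -
  have pos: "\<And>n. a n > 0"
    and dec: "decseq a"
    and lim: "filterlim (\<lambda>N. \<Sum>n=0..N. a n) at_top sequentially"
    using a by (auto simp: weight_seqs_def)
  \<comment> \<open>a multiple of \<open>R\<close> beyond \<open>J\<close>, so that rounding down to a multiple of \<open>R\<close> stays above it\<close>
  define J' where "J' = R * J"
  have J': "J \<le> J'" "R dvd J'"
    using \<open>R > 0\<close> by (auto simp: J'_def)
  define M where "M N = {n. n \<le> N \<and> J' \<le> n \<and> R dvd n}" for N
  have finM: "finite (M N)" for N
    by (rule finite_subset[of _ "{..N}"]) (auto simp: M_def)
  have *: "(\<Sum>n\<in>{J'..N}. a n) \<le> real R * (\<Sum>n\<in>M N. a n)" for N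
  proof -
    have "(\<Sum>n\<in>{J'..N}. a n) \<le> (\<Sum>n\<in>{J'..N}. a (R * (n div R)))"
      using dec by (intro sum_mono) (simp add: decseq_def)
    also have "\<dots> = (\<Sum>m\<in>M N. \<Sum>n | n \<in> {J'..N} \<and> R * (n div R) = m. a (R * (n div R)))"
    proof (rule sum.group[symmetric])
      show "(\<lambda>n. R * (n div R)) ` {J'..N} \<subseteq> M N"
      proof clarsimp
        fix n assume n: "J' \<le> n" "n \<le> N"
        have "R * (J' div R) \<le> R * (n div R)"
          using n by (intro mult_left_mono div_le_mono) auto
        then have "J' \<le> R * (n div R)"
          using J' by simp
        moreover have "R * (n div R) \<le> N"
          using n by (meson le_trans times_div_less_eq_dividend)
        ultimately show "R * (n div R) \<in> M N"
          by (simp add: M_def)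
      qed
    qed (use finM in auto)
    also have "\<dots> \<le> (\<Sum>m\<in>M N. real R * a m)"
    proof (rule sum_mono)
      fix m assume "m \<in> M N"
      have "{n \<in> {J'..N}. R * (n div R) = m} \<subseteq> {m..<m + R}"
        using \<open>R > 0\<close> dividend_less_times_div[of R] by (auto simp: add.commute)
      then have "card {n \<in> {J'..N}. R * (n div R) = m} \<le> R"
        using card_mono[of "{m..<m + R}"] by fastforce
      then show "(\<Sum>n | n \<in> {J'..N} \<and> R * (n div R) = m. a (R * (n div R))) \<le> real R * a m"
        using pos[of m] by (simp add: mult_right_mono)
    qed
    finally show ?thesis
      by (simp add: sum_distrib_left)
  qed
  have "\<forall>\<^sub>F N in sequentially. 2 * (\<Sum>n<J'. a n) < (\<Sum>n=0..N. a n)"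
    using lim by (simp add: filterlim_at_top_dense)
  then show ?thesis
  proof eventually_elim
    case (elim N)
    have "(\<Sum>n=0..N. a n) \<le> (\<Sum>n\<in>{..<J'} \<union> {J'..N}. a n)"
      using pos by (intro sum_mono2) (auto intro: less_imp_le)
    also have "\<dots> = (\<Sum>n<J'. a n) + (\<Sum>n\<in>{J'..N}. a n)"
      by (rule sum.union_disjoint) auto
    finally have "(\<Sum>n=0..N. a n) < 2 * (\<Sum>n\<in>{J'..N}. a n)"
      using elim by linarith
    also have "\<dots> \<le> 2 * (real R * (\<Sum>n\<in>M N. a n))"
      using * by simp
    also have "(\<Sum>n\<in>M N. a n) \<le> (\<Sum>n | n \<le> N \<and> J \<le> n \<and> R dvd n. a n)"
      using pos J' by (intro sum_mono2) (auto simp: M_def intro: less_imp_le)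
    finally show ?case
      using \<open>R > 0\<close> by (simp add: field_simps mult_left_mono)
  qed
qed

lemma linear_iterate:
  fixes T :: "'a::real_vector \<Rightarrow> 'a"
  assumes "linear T"
  shows "linear (T ^^ n)"
proof (induction n)
  case 0
  show ?case using linear_id by (simp add: id_def)
next
  case (Suc n)
  then show ?case unfolding funpow.simps by (rule linear_compose[OF _ assms])
qed

lemma continuous_on_funpow:
  fixes T :: "'a::topological_space \<Rightarrow> 'a"
  assumes "continuous_on UNIV T"
  shows "continuous_on UNIV (T ^^ n)"
proof (induction n)
  case (Suc n)
  have "continuous_on UNIV (T \<circ> (T ^^ n))"
    by (intro continuous_on_compose Suc continuous_on_subset[OF assms]) auto
  then show ?case by simp
qed auto

lemma funpow_periodic:
  assumes "(T ^^ R) p = p"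
  shows "(T ^^ (R * k)) p = p"
  by (induction k) (simp_all add: funpow_add assms)

lemma le_limsup_if_frequently:
  fixes f :: "nat \<Rightarrow> real"
  assumes "\<And>M. \<exists>N\<ge>M. c \<le> f N"
  shows "ereal c \<le> limsup (\<lambda>N. ereal (f N))"
proof (rule Limsup_greatest)
  fix P :: "nat \<Rightarrow> bool" assume "eventually P sequentially"
  then obtain M where M: "\<And>N. N \<ge> M \<Longrightarrow> P N"
    by (auto simp: eventually_sequentially)
  obtain N where "N \<ge> M" "c \<le> f N"
    using assms by blast
  then show "ereal c \<le> (SUP N\<in>Collect P. ereal (f N))"
    using M by (intro SUP_upper2[of N]) auto
qed

text \<open>Every non-empty open set \<open>V\<close> contains a periodic vector \<open>p\<close>, of period \<open>R\<close> say, and any vector \<open>x\<close>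
  is close to \<open>p + y\<close> for some \<open>y\<close> that a power of \<open>T\<close> annihilates. The orbit of \<open>p + y\<close> is in the
  end that of \<open>p\<close>, so it visits \<open>V\<close> along all large multiples of \<open>R\<close>. Hence the vectors whose
  visits to \<open>V\<close> have weighted frequency above \<open>1 / (2 * R)\<close> at some time beyond \<open>M\<close> form a
  dense set, which is open because finitely many visits decide membership. The bound depends on
  \<open>V\<close> only, and not on the approximated vector, so Baire's theorem provides one vector for all
  \<open>V\<close> in a countable family that is finer than every open set.\<close>

theorem U_frequently_hypercyclic_wrt_if_dense_periodic_dense_nilpotent:
  fixes T :: "'a::banach \<Rightarrow> 'a" and D :: "'a set"
  assumes cont: "continuous_on UNIV T" and add: "linear T"
    and D: "countable D" "closure D = UNIV"
    and per: "closure {p. \<exists>R>0. (T ^^ R) p = p} = UNIV"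
    and nil: "closure {y. \<exists>m. (T ^^ m) y = 0} = UNIV"
    and a: "a \<in> weight_seqs"
  shows "U_frequently_hypercyclic_wrt a T"
proof -
  have pos: "a n > 0" for n
    using a by (auto simp: weight_seqs_def)
  define \<V> where "\<V> = (\<lambda>(d, k). ball d (inverse (real (Suc k)))) ` (D \<times> UNIV)"
  have "countable \<V>"
    unfolding \<V>_def using D by simp
  have base: "\<exists>V\<in>\<V>. V \<subseteq> U" if "open U" and ne: "U \<noteq> {}" for U
  proof -
    obtain x where "x \<in> U" using ne by auto
    then obtain e where e: "e > 0" "ball x e \<subseteq> U"
      using \<open>open U\<close> open_contains_ball by blast
    obtain k where k: "inverse (real (Suc k)) < e / 2"
      using reals_Archimedean[of "e / 2"] e by auto
    have "x \<in> closure D"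
      using D by simp
    then obtain d where d: "d \<in> D" "dist d x < e / 2"
      using e half_gt_zero closure_approachable by metis
    have "ball d (inverse (real (Suc k))) \<subseteq> ball x e"
    proof
      fix y assume "y \<in> ball d (inverse (real (Suc k)))"
      then show "y \<in> ball x e"
        using d k dist_triangle[of x y d] by (simp add: dist_commute)
    qed
    moreover have "ball d (inverse (real (Suc k))) \<in> \<V>"
      using d by (force simp: \<V>_def)
    ultimately show ?thesis
      using e by blast
  qed
  have \<V>: "open V" "V \<noteq> {}" if "V \<in> \<V>" for V
    using that by (auto simp: \<V>_def)
  have "\<exists>p R. p \<in> V \<and> R > 0 \<and> (T ^^ R) p = p" if "V \<in> \<V>" for V
  proof -
    have "V \<inter> {p. \<exists>R>0. (T ^^ R) p = p} \<noteq> {}"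
      using open_Int_closure_eq_empty[OF \<V>(1)[OF that], of "{p. \<exists>R>0. (T ^^ R) p = p}"] \<V>(2)[OF that]
      unfolding per by simp
    then show ?thesis by blast
  qed
  then obtain p R where p: "\<And>V. V \<in> \<V> \<Longrightarrow> p V \<in> V" and R: "\<And>V. V \<in> \<V> \<Longrightarrow> R V > (0 :: nat)"
    and pR: "\<And>V. V \<in> \<V> \<Longrightarrow> (T ^^ R V) (p V) = p V"
    by metis
  define Q where "Q V N = {x. (\<Sum>n=0..N. a n) / (2 * real (R V))
      < (\<Sum>n\<in>{0..N} \<inter> return_times T x V. a n)}" for V N
  define G where "G V M = (\<Union>N\<in>{M..}. Q V N)" for V M
  have open_Q: "open (Q V N)" if "V \<in> \<V>" for V N
  proof (rule Topological_Spaces.openI)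
    fix x assume x: "x \<in> Q V N"
    define O' where "O' = (\<Inter>n\<in>{0..N} \<inter> return_times T x V. (T ^^ n) -` V)"
    have "open ((T ^^ n) -` V)" for n
      by (rule open_vimage[OF \<V>(1)[OF that] continuous_on_funpow[OF cont]])
    then have "open O'"
      unfolding O'_def by (intro open_INT) auto
    moreover have "x \<in> O'"
      by (auto simp: O'_def return_times_def)
    moreover have "O' \<subseteq> Q V N"
    proof
      fix y assume "y \<in> O'"
      then have "{0..N} \<inter> return_times T x V \<subseteq> {0..N} \<inter> return_times T y V"
        by (auto simp: O'_def return_times_def)
      then have "(\<Sum>n\<in>{0..N} \<inter> return_times T x V. a n)
          \<le> (\<Sum>n\<in>{0..N} \<inter> return_times T y V. a n)"
        using pos by (intro sum_mono2) (auto intro: less_imp_le)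
      then show "y \<in> Q V N"
        using x by (simp add: Q_def)
    qed
    ultimately show "\<exists>S. open S \<and> x \<in> S \<and> S \<subseteq> Q V N" by blast
  qed
  have dense_G: "closure (G V M) = UNIV" if V: "V \<in> \<V>" for V M
  proof -
    have "x \<in> closure (G V M)" for x
    proof -
      have "\<exists>z\<in>G V M. dist z x < e" if "e > 0" for e
      proof -
        have "x - p V \<in> closure {y. \<exists>m. (T ^^ m) y = 0}"
          using nil by simp
        then have "\<exists>y\<in>{y. \<exists>m. (T ^^ m) y = 0}. dist y (x - p V) < e"
          unfolding closure_approachable using \<open>e > 0\<close> by simp
        then obtain y m where y: "(T ^^ m) y = 0" "dist y (x - p V) < e"
          by auto
        let ?z = "p V + y"
        have "(T ^^ n) y = 0" if "n \<ge> m" for n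
        proof -
          have "(T ^^ k) 0 = 0" for k
            by (induction k) (simp_all add: linear_0[OF add])
          then show ?thesis
            using y that funpow_add[of "n - m" m T] by simp
        qed
        then have ret: "n \<in> return_times T ?z V" if "n \<ge> m" "R V dvd n" for n
        proof -
          obtain k where "n = R V * k"
            using \<open>R V dvd n\<close> by (rule dvdE)
          then show ?thesis
            using that p[OF V] funpow_periodic[OF pR[OF V], of k] \<open>\<And>n. n \<ge> m \<Longrightarrow> (T ^^ n) y = 0\<close>
            by (simp add: return_times_def linear_add[OF linear_iterate[OF add]])
        qed
        have "\<forall>\<^sub>F N in sequentially. N \<ge> M \<and> ?z \<in> Q V N"
          using eventually_weighted_multiples_ge[OF a R[OF V], of m] eventually_ge_at_top[of M]
        proof eventually_elim
          case (elim N)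
          have "(\<Sum>n | n \<le> N \<and> m \<le> n \<and> R V dvd n. a n)
              \<le> (\<Sum>n\<in>{0..N} \<inter> return_times T ?z V. a n)"
            using pos ret by (intro sum_mono2) (auto intro: less_imp_le)
          then show ?case
            using elim by (simp add: Q_def)
        qed
        then have "?z \<in> G V M"
          unfolding G_def by (auto simp: eventually_sequentially)
        moreover have "dist ?z x < e"
          using y by (simp add: dist_norm algebra_simps)
        ultimately show ?thesis by blast
      qed
      then show ?thesis
        unfolding closure_approachable by simp
    qed
    then show ?thesis by blast
  qed
  have "closure (\<Inter>(V, M)\<in>\<V> \<times> UNIV. G V M) = UNIV"
  proof (rule Baire_complete)
    show "countable ((\<lambda>(V, M). G V M) ` (\<V> \<times> UNIV))"
      using \<open>countable \<V>\<close> by simp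
    fix S assume "S \<in> (\<lambda>(V, M). G V M) ` (\<V> \<times> UNIV)"
    then obtain V M where S: "V \<in> \<V>" "S = G V M"
      by auto
    show "open S"
      unfolding S G_def using open_Q[OF S(1)] by blast
    show "closure S = UNIV"
      unfolding S by (rule dense_G[OF S(1)])
  qed
  then have "(\<Inter>(V, M)\<in>\<V> \<times> UNIV. G V M) \<noteq> {}"
    by (metis UNIV_not_empty closure_empty)
  then obtain x where x: "\<And>V M. V \<in> \<V> \<Longrightarrow> x \<in> G V M"
    by fastforce
  have "upper_density_wrt a (return_times T x U) > 0" if U: "open U" "U \<noteq> {}" for U
  proof -
    obtain V where V: "V \<in> \<V>" "V \<subseteq> U"
      using base[OF U] by blast
    define f where "f N = (\<Sum>n\<in>{0..N} \<inter> return_times T x U. a n) / (\<Sum>n=0..N. a n)" for N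
    have "\<exists>N\<ge>M. 1 / (2 * real (R V)) \<le> f N" for M
    proof -
      obtain N where N: "N \<ge> M" "x \<in> Q V N"
        using x[OF V(1), of M] by (auto simp: G_def)
      have "(\<Sum>n\<in>{0..N} \<inter> return_times T x V. a n) \<le> (\<Sum>n\<in>{0..N} \<inter> return_times T x U. a n)"
        using pos V by (intro sum_mono2) (auto simp: return_times_def intro: less_imp_le)
      moreover have "(\<Sum>n=0..N. a n) > 0"
        using pos by (intro sum_pos) auto
      ultimately show ?thesis
        using N by (intro exI[of _ N]) (auto simp: Q_def f_def field_simps)
    qed
    then have "ereal (1 / (2 * real (R V))) \<le> upper_density_wrt a (return_times T x U)"
      unfolding upper_density_wrt_def f_def[symmetric] by (rule le_limsup_if_frequently)
    moreover have "0 < ereal (1 / (2 * real (R V)))"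
      using R[OF V(1)] by simp
    ultimately show ?thesis
      by (rule less_le_trans[rotated])
  qed
  then show ?thesis
    unfolding U_frequently_hypercyclic_wrt_def by blast
qed

section \<open>Blocks and weights\<close>

definition block_start :: "nat \<Rightarrow> nat" where
  "block_start n = (\<Sum>m<n. 8 ^ m)"

lemma block_start_0 [simp]: "block_start 0 = 0"
  and block_start_Suc [simp]: "block_start (Suc n) = block_start n + 8 ^ n"
  by (simp_all add: block_start_def)

lemma block_start_mono: "m \<le> n \<Longrightarrow> block_start m \<le> block_start n"
  unfolding block_start_def by (rule sum_mono2) auto

lemma le_block_start: "n \<le> block_start n"
proof (induction n)
  case (Suc n)
  have "(1::nat) \<le> 8 ^ n" by simp
  with Suc show ?case unfolding block_start_Suc by linarith
qed simp

definition block_of :: "nat \<Rightarrow> nat" where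
  "block_of k = (LEAST n. k < block_start (Suc n))"

lemma block_of_eq:
  assumes "q < 8 ^ n"
  shows "block_of (block_start n + q) = n"
  unfolding block_of_def
proof (rule Least_equality)
  show "block_start n + q < block_start (Suc n)"
    using assms by simp
next
  fix m assume "block_start n + q < block_start (Suc m)"
  then show "n \<le> m"
    using block_start_mono[of "Suc m" n] by (cases "Suc m \<le> n") linarith+
qed

lemma block_cases:
  obtains n q where "k = block_start n + q" "q < 8 ^ n"
proof -
  have "\<exists>n. k < block_start (Suc n)"
    using le_block_start[of "Suc k"] Suc_le_lessD by blast
  then have k: "k < block_start (Suc (block_of k))"
    unfolding block_of_def by (rule LeastI_ex)
  have "block_start (block_of k) \<le> k"
  proof (cases "block_of k")
    case (Suc m)
    then have "\<not> k < block_start (Suc m)"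
      unfolding block_of_def by (metis lessI not_less_Least)
    with Suc show ?thesis by simp
  qed simp
  with k show ?thesis
    by (intro that[of "block_of k" "k - block_start (block_of k)"]) auto
qed

text \<open>The weight starts at \<open>1 / 2 ^ n\<close> at the beginning of block \<open>n\<close>, doubles at each of the next
  \<open>ramp_length n\<close> positions and then stays at \<open>16 ^ n\<^sup>2\<close> up to the end of the block. Three things
  are needed: the initial weight tends to \<open>0\<close>, the ramp is short compared with the length \<open>8 ^ n\<close>
  of the block, and the plateau dominates the sum of all weights of the earlier blocks.\<close>

definition ramp_length :: "nat \<Rightarrow> nat" where
  "ramp_length n = 4 * n\<^sup>2 + n"

definition weight :: "nat \<Rightarrow> real" where
  "weight k = (let n = block_of k in 2 ^ min (k - block_start n) (ramp_length n) / 2 ^ n)"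

lemma weight_eq:
  "q < 8 ^ n \<Longrightarrow> weight (block_start n + q) = 2 ^ min q (ramp_length n) / 2 ^ n"
  by (simp add: weight_def block_of_eq)

lemma weight_pos [simp]: "weight k > 0"
  by (simp add: weight_def Let_def)

lemma weight_nonneg [simp]: "weight k \<ge> 0" and weight_neq_0 [simp]: "weight k \<noteq> 0"
  using weight_pos[of k] by linarith+

lemma weight_high:
  assumes "q < 8 ^ n" "ramp_length n \<le> q"
  shows "weight (block_start n + q) = 16 ^ n\<^sup>2"
  using assms by (simp add: weight_eq ramp_length_def power_add power_mult)

lemma weight_le:
  assumes "q < 8 ^ n"
  shows "weight (block_start n + q) \<le> 16 ^ n\<^sup>2"
proof -
  have "(2::real) ^ min q (ramp_length n) \<le> 2 ^ ramp_length n"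
    by (rule power_increasing) auto
  also have "\<dots> = 16 ^ n\<^sup>2 * 2 ^ n"
    by (simp add: ramp_length_def power_add power_mult)
  finally show ?thesis
    using assms unfolding weight_eq[OF assms] by (simp add: divide_le_eq)
qed

lemma weight_Suc_le:
  assumes "Suc q < 8 ^ n"
  shows "weight (block_start n + Suc q) \<le> 2 * weight (block_start n + q)"
proof -
  have "(2::real) ^ min (Suc q) (ramp_length n) \<le> 2 ^ Suc (min q (ramp_length n))"
    by (rule power_increasing) auto
  then show ?thesis
    using assms weight_eq[of "Suc q" n] weight_eq[of q n] by (simp add: divide_right_mono)
qed

lemma weight_ge_1:
  assumes "q < 8 ^ n" "n \<le> q"
  shows "weight (block_start n + q) \<ge> 1"
proof -
  have "(2::real) ^ n \<le> 2 ^ min q (ramp_length n)"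
    using assms by (intro power_increasing) (auto simp: ramp_length_def)
  then show ?thesis
    using assms by (simp add: weight_eq)
qed

text \<open>The last \<open>8 ^ n\<close> positions of block \<open>n + 1\<close>, and hence those of every later block, lie on the
  plateau. So whatever leaves a later block during one lap of block \<open>n\<close> comes from positions
  with a huge weight.\<close>

lemma ramp_length_le: "ramp_length (Suc n) + 8 ^ n \<le> 8 ^ Suc n"
proof -
  have "4 * (Suc n)\<^sup>2 + Suc n \<le> 7 * 8 ^ n"
  proof (induction n)
    case (Suc n)
    then show ?case by (simp add: power2_eq_square)
  qed simp
  then show ?thesis by (simp add: ramp_length_def)
qed

lemma ramp_length_less: "ramp_length n < 8 ^ n"
proof (cases n)
  case (Suc m)
  have "(0::nat) < 8 ^ m" by simp
  with ramp_length_le[of m] show ?thesis unfolding Suc by linarith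
qed (simp add: ramp_length_def)

lemma sum_lessThan_plus:
  fixes f :: "nat \<Rightarrow> 'a::comm_monoid_add"
  shows "(\<Sum>k<a + m. f k) = (\<Sum>k<a. f k) + (\<Sum>q<m. f (a + q))"
  by (induction m) (simp_all add: add.assoc)

text \<open>This makes the operator bounded: the vector that is emitted at the end of block \<open>n\<close> turns out to
  have coordinates at most \<open>weight k\<close> in the earlier blocks.\<close>

lemma sum_weight_le: "(\<Sum>k<block_start n. weight k) \<le> 16 ^ n\<^sup>2"
proof (induction n)
  case (Suc n)
  have "(\<Sum>k<block_start (Suc n). weight k) =
      (\<Sum>k<block_start n. weight k) + (\<Sum>q<8 ^ n. weight (block_start n + q))"
    by (simp add: sum_lessThan_plus)
  also have "\<dots> \<le> 16 ^ n\<^sup>2 + (\<Sum>q<8 ^ n :: nat. 16 ^ n\<^sup>2)"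
    using Suc by (intro add_mono sum_mono) (auto intro: weight_le)
  also have "\<dots> \<le> 16 ^ n\<^sup>2 * (2 * 8 ^ n)"
    by simp
  also have "(2::real) * 8 ^ n \<le> 16 * 256 ^ n"
    by (intro mult_mono power_mono) auto
  also have "16 ^ n\<^sup>2 * (16 * 256 ^ n) = (16::real) ^ (Suc n)\<^sup>2"
  proof -
    have "(Suc n)\<^sup>2 = n\<^sup>2 + (1 + 2 * n)"
      by (simp add: power2_eq_square)
    moreover have "(16::real) ^ (n\<^sup>2 + (1 + 2 * n)) = 16 ^ n\<^sup>2 * (16 * (16\<^sup>2) ^ n)"
      unfolding power_add power_mult power_one_right by (rule refl)
    moreover have "(16::real)\<^sup>2 = 256"
      by simp
    ultimately show ?thesis
      by (simp only:)
  qed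
  finally show ?case by simp
qed simp

lemma less_8_power: "q \<le> n \<Longrightarrow> q < 8 ^ n"
  using less_exp[of n] power_mono[of 2 "8 :: nat" n] by linarith

definition basis_vec :: "nat \<Rightarrow> ell1" where
  "basis_vec k = scaleC_ell1 (of_real (weight k)) (unit_ell1 k)"

lemma nth_basis_vec: "ell1_nth (basis_vec k) i = (if i = k then of_real (weight k) else 0)"
  by (simp add: basis_vec_def)

lemma norm_basis_vec: "norm (basis_vec k) = weight k"
  by (simp add: basis_vec_def norm_scaleC_ell1)

lemma unit_eq_basis_vec: "unit_ell1 k = scaleC_ell1 (of_real (1 / weight k)) (basis_vec k)"
  by (rule ell1_eqI) (simp add: nth_basis_vec)

definition below_block :: "nat \<Rightarrow> ell1 \<Rightarrow> bool" where
  "below_block n y \<longleftrightarrow> (\<forall>k\<ge>block_start n. ell1_nth y k = 0)"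

lemma below_block_mono: "below_block m y \<Longrightarrow> m \<le> n \<Longrightarrow> below_block n y"
  unfolding below_block_def using block_start_mono le_trans by blast

lemma below_block_add: "below_block n x \<Longrightarrow> below_block n y \<Longrightarrow> below_block n (x + y)"
  and below_block_diff: "below_block n x \<Longrightarrow> below_block n y \<Longrightarrow> below_block n (x - y)"
  and below_block_scaleC: "below_block n x \<Longrightarrow> below_block n (scaleC_ell1 c x)"
  by (simp_all add: below_block_def)

lemma below_block_sum: "(\<And>i. i \<in> A \<Longrightarrow> below_block n (f i)) \<Longrightarrow> below_block n (\<Sum>i\<in>A. f i)"
  by (simp add: below_block_def ell1_nth_sum)

lemma below_block_basis_vec: "k < block_start n \<Longrightarrow> below_block n (basis_vec k)"
  by (auto simp: below_block_def nth_basis_vec)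

lemma below_block_expansion:
  assumes "below_block n y"
  shows "y = (\<Sum>k<block_start n. scaleC_ell1 (ell1_nth y k) (unit_ell1 k))"
  using assms
  by (intro ell1_eqI)
     (auto simp: below_block_def ell1_nth_sum if_distrib[of "\<lambda>c. _ * c"] not_less cong: if_cong)

lemma block_start_less_imp:
  assumes "block_start m + q < block_start n"
  shows "m < n"
  using assms block_start_mono[of n m] by (cases "n \<le> m") linarith+

text \<open>The sum of the moduli of the coefficients with respect to the vectors \<open>basis_vec k\<close>.\<close>

definition mass_below :: "nat \<Rightarrow> ell1 \<Rightarrow> real" where
  "mass_below n y = (\<Sum>k<block_start n. norm (ell1_nth y k) / weight k)"

lemma mass_below_eq:
  assumes "below_block m y" "m \<le> n"
  shows "mass_below n y = mass_below m y"
  unfolding mass_below_def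
  using assms block_start_mono[OF assms(2)]
  by (intro sum.mono_neutral_right) (auto simp: below_block_def)

lemma mass_below_scaleR: "mass_below n (r *\<^sub>R y) = \<bar>r\<bar> * mass_below n y"
  by (simp add: mass_below_def sum_distrib_left)

section \<open>Orbits of block operators\<close>

text \<open>On the finitely supported vectors the operator is a direct sum of shifts in disguise: with respect
  to the vectors \<open>(T ^^ q) (basis_vec (block_start n) - v n)\<close> it is, on each block, a cyclic
  permutation if \<open>lam n = 1\<close> and a nilpotent shift if \<open>lam n = 0\<close>. The norm, however, is the one for
  which the vectors \<open>basis_vec k\<close> are the rescaled unit vectors. As \<open>basis_vec (block_start n)\<close> is
  tiny, \<open>v n\<close> is close to a periodic vector, respectively to a vector that a power of \<open>T\<close>
  annihilates. The mass condition on \<open>v n\<close> is what keeps all orbits of basis vectors bounded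
  coordinatewise.\<close>

locale block_operator =
  fixes T :: "ell1 \<Rightarrow> ell1" and v :: "nat \<Rightarrow> ell1" and lam :: "nat \<Rightarrow> complex"
  assumes bounded: "bounded_linear T"
    and scale: "T (scaleC_ell1 c x) = scaleC_ell1 c (T x)"
    and step: "Suc q < 8 ^ n \<Longrightarrow> T (basis_vec (block_start n + q)) = basis_vec (block_start n + Suc q)"
    and wrap: "(T ^^ (8 ^ n)) (basis_vec (block_start n) - v n)
        = scaleC_ell1 (lam n) (basis_vec (block_start n) - v n)"
    and lam: "lam n = 0 \<or> lam n = 1"
    and v_below: "below_block n (v n)"
    and v_mass: "mass_below n (v n) \<le> 1 / 2"
begin

lemma bounded_funpow: "bounded_linear (T ^^ j)"
proof (induction j)
  case (Suc j)
  have "bounded_linear (T \<circ> (T ^^ j))"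
    unfolding comp_def by (rule bounded_linear_compose[OF bounded Suc])
  then show ?case unfolding funpow.simps .
next
  case 0
  show ?case by (simp add: id_def)
qed

lemma scale_funpow: "(T ^^ j) (scaleC_ell1 c x) = scaleC_ell1 c ((T ^^ j) x)"
  by (induction j) (simp_all add: scale)

lemmas linear_funpow = bounded_linear.linear[OF bounded_funpow]

lemma funpow_basis_vec:
  "q + j < 8 ^ n \<Longrightarrow> (T ^^ j) (basis_vec (block_start n + q)) = basis_vec (block_start n + q + j)"
proof (induction j)
  case (Suc j)
  then show ?case
    using step[of "q + j" n] by (simp add: add.assoc)
qed simp

text \<open>Splitting \<open>basis_vec (block_start n)\<close> into \<open>v n\<close> and the difference, on which \<open>T ^^ (8 ^ n)\<close>
  acts as multiplication by \<open>lam n\<close>. At each time at most two vectors from the orbit of \<open>v n\<close>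
  are present, one added and one subtracted, so nothing accumulates over the laps.\<close>

lemma orbit_formula:
  "(T ^^ N) (basis_vec (block_start n)) = (T ^^ N) (v n) +
     scaleC_ell1 (lam n ^ (N div 8 ^ n))
       (basis_vec (block_start n + N mod 8 ^ n) - (T ^^ (N mod 8 ^ n)) (v n))"
proof -
  let ?d = "basis_vec (block_start n) - v n"
  have wraps: "(T ^^ (8 ^ n * k)) ?d = scaleC_ell1 (lam n ^ k) ?d" for k
    by (induction k) (simp_all add: funpow_add wrap scale_funpow mult.commute)
  have "(T ^^ N) ?d = (T ^^ (N mod 8 ^ n + 8 ^ n * (N div 8 ^ n))) ?d"
    by simp
  also have "\<dots> = scaleC_ell1 (lam n ^ (N div 8 ^ n)) ((T ^^ (N mod 8 ^ n)) ?d)"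
    by (simp only: funpow_add comp_apply wraps scale_funpow)
  also have "(T ^^ (N mod 8 ^ n)) ?d =
      basis_vec (block_start n + N mod 8 ^ n) - (T ^^ (N mod 8 ^ n)) (v n)"
    using funpow_basis_vec[of 0 "N mod 8 ^ n" n] by (simp add: linear_diff[OF linear_funpow])
  finally show ?thesis
    using linear_diff[OF linear_funpow, of N "basis_vec (block_start n)" "v n"]
    by (metis add.commute diff_add_cancel)
qed

text \<open>The operator feeds each block into earlier blocks only. At the end of block \<open>m\<close> the image is
  determined by the orbit of \<open>v m\<close>, which is why the induction is over the blocks.\<close>

lemma below_block_T: "below_block n y \<Longrightarrow> below_block n (T y)"
proof (induction n arbitrary: y rule: less_induct)
  case (less n)
  have pow: "below_block m ((T ^^ i) y)" if "m < n" "below_block m y" for m i y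
    by (induction i) (simp_all add: that less.IH)
  have unit: "below_block n (T (unit_ell1 k))" if k: "k < block_start n" for k
  proof -
    obtain m q where mq: "k = block_start m + q" "q < 8 ^ m"
      by (rule block_cases)
    have "m < n"
      using block_start_less_imp k mq by blast
    then have m: "block_start m + 8 ^ m \<le> block_start n"
      using block_start_mono[of "Suc m" n] by simp
    have "below_block n (T (basis_vec k))"
    proof (cases "Suc q < 8 ^ m")
      case True
      then show ?thesis
        unfolding mq step[OF True] using m by (intro below_block_basis_vec) linarith
    next
      case False
      then have q: "8 ^ m = Suc q"
        using mq by simp
      have "T (basis_vec k) = (T ^^ 8 ^ m) (basis_vec (block_start m))"
        unfolding q using funpow_basis_vec[of 0 q m] mq by simp
      also have "below_block n \<dots>"
      proof -
        have "below_block n ((T ^^ i) (v m))" for i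
          using pow[OF \<open>m < n\<close> v_below] \<open>m < n\<close> by (meson below_block_mono less_imp_le)
        moreover have "below_block n (v m)"
          using below_block_mono[OF v_below] \<open>m < n\<close> by simp
        moreover have "below_block n (basis_vec (block_start m))"
          using m by (intro below_block_basis_vec) (simp add: Suc_le_lessD[of _ "block_start n"] q)
        ultimately show ?thesis
          unfolding orbit_formula[of "8 ^ m"]
          by (intro below_block_add below_block_scaleC below_block_diff) simp_all
      qed
      finally show ?thesis .
    qed
    then show ?thesis
      by (simp add: unit_eq_basis_vec scale below_block_scaleC)
  qed
  show ?case
    by (subst below_block_expansion[OF less.prems])
       (auto simp: linear_sum[OF bounded_linear.linear[OF bounded]] scale
          intro!: below_block_sum below_block_scaleC unit)
qed

lemma below_block_funpow: "below_block n y \<Longrightarrow> below_block n ((T ^^ i) y)"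
  by (induction i) (simp_all add: below_block_T)

lemma norm_lam_power_le: "norm (lam n ^ i) \<le> 1"
  using lam[of n] by (auto simp: norm_power power_0_left)

lemma funpow_block_eq: "(T ^^ j) (basis_vec (block_start n + q)) = (T ^^ (q + j)) (basis_vec (block_start n))"
  if "q < 8 ^ n"
  using funpow_basis_vec[of 0 q n] that by (simp add: funpow_add add.commute[of q])

lemma coordinate_unit: "ell1_nth ((T ^^ j) (unit_ell1 k)) i = ell1_nth ((T ^^ j) (basis_vec k)) i / weight k"
  by (simp add: unit_eq_basis_vec scale_funpow)

lemma coordinate_le_mass_if:
  assumes "below_block n y"
    and le: "\<And>k. k < block_start n \<Longrightarrow> norm (ell1_nth ((T ^^ r) (basis_vec k)) i) \<le> weight i"
  shows "norm (ell1_nth ((T ^^ r) y) i) \<le> weight i * mass_below n y"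
proof -
  have "(T ^^ r) y = (\<Sum>k<block_start n. scaleC_ell1 (ell1_nth y k) ((T ^^ r) (unit_ell1 k)))"
    by (subst below_block_expansion[OF assms(1)])
       (simp add: linear_sum[OF linear_funpow] scale_funpow)
  then have "norm (ell1_nth ((T ^^ r) y) i) \<le>
      (\<Sum>k<block_start n. norm (ell1_nth y k * ell1_nth ((T ^^ r) (unit_ell1 k)) i))"
    by (simp add: ell1_nth_sum norm_sum)
  also have "\<dots> \<le> (\<Sum>k<block_start n. weight i * (norm (ell1_nth y k) / weight k))"
  proof (rule sum_mono)
    fix k assume "k \<in> {..<block_start n}"
    then have "norm (ell1_nth ((T ^^ r) (unit_ell1 k)) i) \<le> weight i / weight k"
      using le[of k] by (simp add: coordinate_unit norm_divide divide_right_mono)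
    from mult_left_mono[OF this, of "norm (ell1_nth y k)"]
    show "norm (ell1_nth y k * ell1_nth ((T ^^ r) (unit_ell1 k)) i)
        \<le> weight i * (norm (ell1_nth y k) / weight k)"
      by (simp add: norm_mult mult_ac)
  qed
  finally show ?thesis
    by (simp add: mass_below_def sum_distrib_left)
qed

text \<open>Coefficients of orbits of basis vectors never exceed \<open>1\<close>. The orbit formula bounds them in the
  earlier blocks by the contributions of two orbit segments of \<open>v n\<close>, and each of these is at
  most \<open>1 / 2\<close> by induction because \<open>v n\<close> has mass at most \<open>1 / 2\<close>.\<close>

lemma coordinate_le: "norm (ell1_nth ((T ^^ j) (basis_vec k)) i) \<le> weight i"
proof -
  have "norm (ell1_nth ((T ^^ N) (basis_vec (block_start n))) i) \<le> weight i" for N n i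
  proof (induction n arbitrary: N i rule: less_induct)
    case (less n)
    have v: "norm (ell1_nth ((T ^^ r) (v n)) i) \<le> weight i / 2" for r
    proof -
      have "norm (ell1_nth ((T ^^ r) (v n)) i) \<le> weight i * mass_below n (v n)"
      proof (rule coordinate_le_mass_if[OF v_below])
        fix k assume k: "k < block_start n"
        obtain m q where mq: "k = block_start m + q" "q < 8 ^ m"
          by (rule block_cases)
        then show "norm (ell1_nth ((T ^^ r) (basis_vec k)) i) \<le> weight i"
          using less.IH[of m] block_start_less_imp k by (auto simp: funpow_block_eq)
      qed
      then show ?thesis
        using mult_left_mono[OF v_mass[of n] weight_nonneg[of i]] by linarith
    qed
    define r where "r = N mod 8 ^ n"
    define l where "l = lam n ^ (N div 8 ^ n)"
    have l: "norm l \<le> 1"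
      unfolding l_def by (rule norm_lam_power_le)
    have eq: "ell1_nth ((T ^^ N) (basis_vec (block_start n))) i = ell1_nth ((T ^^ N) (v n)) i
        + l * (ell1_nth (basis_vec (block_start n + r)) i - ell1_nth ((T ^^ r) (v n)) i)"
      unfolding r_def l_def by (subst orbit_formula) simp
    show ?case
    proof (cases "i < block_start n")
      case True
      then have "ell1_nth (basis_vec (block_start n + r)) i = 0"
        by (simp add: nth_basis_vec)
      then have "norm (ell1_nth ((T ^^ N) (basis_vec (block_start n))) i)
          \<le> norm (ell1_nth ((T ^^ N) (v n)) i) + norm l * norm (ell1_nth ((T ^^ r) (v n)) i)"
        unfolding eq using norm_triangle_ineq4[of "ell1_nth ((T ^^ N) (v n)) i" "l * ell1_nth ((T ^^ r) (v n)) i"]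
        by (simp add: norm_mult)
      also have "\<dots> \<le> weight i / 2 + 1 * (weight i / 2)"
        using v l by (intro add_mono mult_mono) auto
      finally show ?thesis by simp
    next
      case False
      then have "ell1_nth ((T ^^ s) (v n)) i = 0" for s
        using below_block_funpow[OF v_below] by (simp add: below_block_def)
      then show ?thesis
        unfolding eq using l by (simp add: nth_basis_vec norm_mult mult_left_le_one_le)
    qed
  qed
  note * = this
  obtain n q where "k = block_start n + q" "q < 8 ^ n"
    by (rule block_cases)
  then show ?thesis
    using * by (simp add: funpow_block_eq)
qed

lemma coordinate_le_mass:
  "below_block n y \<Longrightarrow> norm (ell1_nth ((T ^^ r) y) i) \<le> weight i * mass_below n y"
  by (rule coordinate_le_mass_if[OF _ coordinate_le])

text \<open>As long as position \<open>q0\<close> of block \<open>n\<close> has not completed its lap, the coefficient travelling with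
  it is hardly disturbed by other positions. Earlier blocks do not reach block \<open>n\<close>, and other
  positions of block \<open>n\<close> arrive elsewhere. A later block contributes only through positions that reach
  its end within the time \<open>j < 8 ^ n\<close>, and those lie on a plateau of height at least
  \<open>16 ^ (Suc n)\<^sup>2\<close>.\<close>

lemma coordinate_unit_le:
  assumes "q0 + j < 8 ^ n" "k \<noteq> block_start n + q0"
  defines "i \<equiv> block_start n + q0 + j"
  shows "norm (ell1_nth ((T ^^ j) (unit_ell1 k)) i) \<le> weight i / 16 ^ (Suc n)\<^sup>2"
proof -
  obtain m q where mq: "k = block_start m + q" "q < 8 ^ m"
    by (rule block_cases)
  have i: "block_start n \<le> i" "i < block_start (Suc n)"
    using assms by auto
  have zero: ?thesis if "ell1_nth ((T ^^ j) (basis_vec k)) i = 0"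
    using that by (simp add: coordinate_unit)
  consider "m < n" | "m = n" | "m > n" by linarith
  then show ?thesis
  proof cases
    case 1
    then have "block_start m + 8 ^ m \<le> block_start n"
      using block_start_mono[of "Suc m" n] by simp
    then have "below_block n (basis_vec k)"
      using mq by (intro below_block_basis_vec) linarith
    then show ?thesis
      using below_block_funpow i(1) by (intro zero) (auto simp: below_block_def)
  next
    case 2
    show ?thesis
    proof (cases "q + j < 8 ^ n")
      case True
      then show ?thesis
        using 2 mq assms by (intro zero) (auto simp: funpow_basis_vec nth_basis_vec)
    next
      case False
      have "q + j - 8 ^ n < 8 ^ n" "q + j - 8 ^ n < q0 + j"
        using False mq 2 assms(1) by auto
      then have r: "(q + j) mod 8 ^ n < q0 + j"
        using False by (metis le_mod_geq mod_less not_less)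
      have "ell1_nth ((T ^^ s) (v n)) i = 0" for s
        using below_block_funpow[OF v_below, of n s] i(1) by (simp add: below_block_def)
      then show ?thesis
        using 2 mq r by (intro zero) (simp add: funpow_block_eq orbit_formula[of "q + j"] nth_basis_vec i_def)
    qed
  next
    case 3
    then have *: "block_start n + 8 ^ n \<le> block_start m"
      using block_start_mono[of "Suc n" m] by simp
    show ?thesis
    proof (cases "q + j < 8 ^ m")
      case True
      then show ?thesis
        using mq assms(1) * by (intro zero) (auto simp: funpow_basis_vec nth_basis_vec i_def)
    next
      case False
      obtain m' where m': "m = Suc m'" "n \<le> m'"
        using 3 by (cases m) auto
      have "(8::nat) ^ n \<le> 8 ^ m'"
        using m' by (intro power_increasing) auto
      then have "ramp_length m \<le> q"
        using False assms(1) ramp_length_le[of m'] unfolding m' by linarith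
      then have w: "weight k = 16 ^ m\<^sup>2"
        using mq by (simp add: weight_high)
      have "(16::real) ^ (Suc n)\<^sup>2 \<le> 16 ^ m\<^sup>2"
        using 3 by (intro power_increasing power_mono) auto
      then have "weight i / weight k \<le> weight i / 16 ^ (Suc n)\<^sup>2"
        unfolding w by (intro divide_left_mono) auto
      moreover have "norm (ell1_nth ((T ^^ j) (unit_ell1 k)) i) \<le> weight i / weight k"
        using coordinate_le[of j k i] by (simp add: coordinate_unit norm_divide divide_right_mono)
      ultimately show ?thesis by linarith
    qed
  qed
qed

text \<open>Hence a non-negligible coefficient in block \<open>n\<close> forces the orbit to be large all the time that this
  coefficient spends on the plateau.\<close>

lemma norm_funpow_ge:
  assumes "q + j < 8 ^ n"
  shows "weight (block_start n + q + j) *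
      (norm (ell1_nth x (block_start n + q)) / weight (block_start n + q) - norm x / 16 ^ (Suc n)\<^sup>2)
    \<le> norm ((T ^^ j) x)"
proof -
  define k where "k = block_start n + q"
  define i where "i = k + j"
  define B :: real where "B = weight i / 16 ^ (Suc n)\<^sup>2"
  define y where "y = x - scaleC_ell1 (ell1_nth x k) (unit_ell1 k)"
  have B: "B \<ge> 0"
    by (simp add: B_def)
  have nth_y: "ell1_nth y l = (if l = k then 0 else ell1_nth x l)" for l
    by (simp add: y_def)
  have "norm (ell1_nth ((T ^^ j) y) i) \<le> (\<Sum>l. norm (ell1_nth y l) * B)"
  proof (rule norm_functional_le)
    show "bounded_linear (\<lambda>y. ell1_nth ((T ^^ j) y) i)"
      by (rule bounded_linear_compose[OF bounded_linear_ell1_nth bounded_funpow])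
    show "norm (ell1_nth ((T ^^ j) (unit_ell1 l)) i) \<le> B" if "ell1_nth y l \<noteq> 0" for l
      using coordinate_unit_le[of q j n l] assms that
      by (auto simp: nth_y B_def i_def k_def split: if_splits)
  qed (simp_all add: scale_funpow summable_mult2 summable_ell1_nth)
  also have "\<dots> \<le> (\<Sum>l. norm (ell1_nth x l) * B)"
    by (intro suminf_le summable_mult2 summable_ell1_nth mult_right_mono B) (simp add: nth_y)
  also have "\<dots> = norm x * B"
    unfolding norm_ell1_eq by (rule suminf_mult2[symmetric, OF summable_ell1_nth])
  finally have y: "norm (ell1_nth ((T ^^ j) y) i) \<le> norm x * B" .
  have "x = scaleC_ell1 (ell1_nth x k) (unit_ell1 k) + y"
    by (simp add: y_def)
  then have "(T ^^ j) x = scaleC_ell1 (ell1_nth x k) ((T ^^ j) (unit_ell1 k)) + (T ^^ j) y"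
    by (metis linear_add[OF linear_funpow] scale_funpow)
  then have "ell1_nth ((T ^^ j) x) i = ell1_nth x k * weight i / weight k + ell1_nth ((T ^^ j) y) i"
    using assms by (simp add: coordinate_unit funpow_basis_vec k_def i_def nth_basis_vec)
  then have "norm (ell1_nth x k * weight i / weight k) - norm (ell1_nth ((T ^^ j) y) i)
      \<le> norm (ell1_nth ((T ^^ j) x) i)"
    by (metis norm_diff_ineq)
  also have "\<dots> \<le> norm ((T ^^ j) x)"
    by (rule norm_ell1_nth_le)
  finally have "norm (ell1_nth x k) * weight i / weight k - norm x * B \<le> norm ((T ^^ j) x)"
    using y by (simp add: norm_mult norm_divide)
  then show ?thesis
    by (simp add: B_def k_def i_def algebra_simps)
qed

end

section \<open>Failure of frequent hypercyclicity\<close>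

lemma lower_density_pos_imp_eventually:
  assumes "lower_density I > 0"
  obtains c where "c > 0" "\<forall>\<^sub>F N in sequentially. c < real (card ({0..N} \<inter> I)) / real (N + 1)"
proof -
  obtain c where c: "0 < ereal c" "ereal c < lower_density I"
    using ereal_dense2[OF assms] by blast
  from less_LiminfD[OF c(2)[unfolded lower_density_def]] have
    "\<forall>\<^sub>F N in sequentially. c < real (card ({0..N} \<inter> I)) / real (N + 1)"
    by simp
  with c(1) show ?thesis
    by (intro that[of c]) auto
qed

lemma lower_density_empty: "\<not> lower_density {} > 0"
  by (simp add: lower_density_def zero_ereal_def[symmetric] Liminf_const)

lemma weight_0: "weight 0 = 1"
  using weight_eq[of 0 0] by simp

lemma block_start_Suc_le: "block_start (Suc n) \<le> 2 * 8 ^ n"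
  by (induction n) auto

lemma ramp_length_bound:
  assumes "n \<ge> 3"
  shows "ramp_length n * (n + 1) + n \<le> 8 ^ n"
proof -
  have "ramp_length (m + 3) * (m + 4) + (m + 3) \<le> 8 ^ (m + 3)" for m
    unfolding ramp_length_def
  proof (induction m)
    case (Suc m)
    have "(8::nat) ^ (m + 4) = 8 * 8 ^ (m + 3)"
      by (simp add: power_add)
    with Suc show ?case by (simp add: power2_eq_square algebra_simps)
  qed simp
  from this[of "n - 3"] assms show ?thesis by simp
qed

context block_operator
begin

lemma first_coordinate_bounded:
  assumes "summable (\<lambda>k. norm (ell1_nth x k) * (1 / weight k))"
  shows "norm (ell1_nth ((T ^^ j) x) 0) \<le> (\<Sum>k. norm (ell1_nth x k) * (1 / weight k))"
proof (rule norm_functional_le[OF _ _ _ assms])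
  show "bounded_linear (\<lambda>y. ell1_nth ((T ^^ j) y) 0)"
    by (rule bounded_linear_compose[OF bounded_linear_ell1_nth bounded_funpow])
  show "norm (ell1_nth ((T ^^ j) (unit_ell1 k)) 0) \<le> 1 / weight k" for k
    using coordinate_le[of j k 0]
    by (simp add: coordinate_unit norm_divide divide_right_mono weight_0)
qed (simp add: scale_funpow)

text \<open>An orbit with unbounded first coordinate must start at a vector \<open>x\<close> whose coefficients
  \<open>x\<^sub>k / weight k\<close> are not absolutely summable. Where the weight is at least \<open>1\<close> the coefficients
  are summable because \<open>x\<close> is. So the divergence comes from the first \<open>n\<close> positions of the
  blocks \<open>n\<close>, which are the only ones with weight below \<open>1\<close>; infinitely often the coefficient there
  exceeds the terms of the convergent series of the inverse squares.\<close>

lemma unbounded_imp_deep_mass: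
  assumes unbounded: "\<And>M. \<exists>j. norm (ell1_nth ((T ^^ j) x) 0) > M"
  shows "\<exists>n\<ge>S. \<exists>q<n. 1 / (real (Suc (block_start n + q)))\<^sup>2
    \<le> norm (ell1_nth x (block_start n + q)) / weight (block_start n + q)"
proof (rule ccontr)
  assume *: "\<not> ?thesis"
  have "summable (\<lambda>k. norm (ell1_nth x k) + inverse (real (Suc k) ^ 2))"
    using inverse_power_summable[of 2, where 'a = real]
      summable_Suc_iff[of "\<lambda>k. inverse (real k ^ 2)"]
    by (intro summable_add summable_ell1_nth) simp_all
  then have "summable (\<lambda>k. norm (ell1_nth x k) * (1 / weight k))"
  proof (rule summable_comparison_test'[where N = "block_start S"])
    fix k assume k: "block_start S \<le> k"
    obtain n q where nq: "k = block_start n + q" "q < 8 ^ n"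
      by (rule block_cases)
    have "S \<le> n"
      using k nq block_start_mono[of "Suc n" S] by (cases "S \<le> n") auto
    have "norm (ell1_nth x k) / weight k \<le> norm (ell1_nth x k) + inverse (real (Suc k) ^ 2)"
    proof (cases "q < n")
      case True
      then have "norm (ell1_nth x k) / weight k < 1 / (real (Suc k))\<^sup>2"
        using * \<open>S \<le> n\<close> nq(1) by (metis not_less)
      then show ?thesis
        using norm_ge_zero[of "ell1_nth x k"] by (simp only: inverse_eq_divide)
    next
      case False
      then have "weight k \<ge> 1"
        using nq weight_ge_1 by simp
      then have "norm (ell1_nth x k) / weight k \<le> norm (ell1_nth x k)"
        by (simp add: divide_le_eq mult_left_mono mult_ge1_I mult_le_cancel_left1)
      moreover have "0 \<le> inverse (real (Suc k) ^ 2)"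
        by simp
      ultimately show ?thesis by linarith
    qed
    then show "norm (norm (ell1_nth x k) * (1 / weight k))
        \<le> norm (ell1_nth x k) + inverse (real (Suc k) ^ 2)"
      by simp
  qed
  from first_coordinate_bounded[OF this] show False
    using unbounded by (meson not_less)
qed

text \<open>The lower bound on the coefficient only decays exponentially in \<open>n\<close>, like \<open>1 / (4 * 64 ^ n)\<close>,
  while the height \<open>16 ^ n\<^sup>2\<close> of the plateau grows faster than any exponential, and the next plateau
  is high enough to keep the disturbance from later blocks below \<open>norm x\<close>.\<close>

lemma deep_mass_imp_large_orbit:
  assumes n: "n \<ge> 3" "real n \<ge> norm x + 1" and "q < n"
    and deep: "1 / (real (Suc (block_start n + q)))\<^sup>2
      \<le> norm (ell1_nth x (block_start n + q)) / weight (block_start n + q)"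
    and j: "ramp_length n \<le> q + j" "q + j < 8 ^ n"
  shows "norm ((T ^^ j) x) \<ge> 1"
proof -
  let ?W = "16 ^ n\<^sup>2 :: real" and ?W' = "16 ^ (Suc n)\<^sup>2 :: real"
  have "Suc (block_start n + q) \<le> 2 * 8 ^ n"
    using less_8_power[OF less_imp_le[OF \<open>q < n\<close>]] block_start_Suc_le[of n] by simp
  then have "real (Suc (block_start n + q)) \<le> 2 * 8 ^ n"
    by (metis of_nat_le_iff of_nat_mult of_nat_numeral of_nat_power)
  then have "(real (Suc (block_start n + q)))\<^sup>2 \<le> (2 * 8 ^ n)\<^sup>2"
    by (intro power_mono) auto
  also have "\<dots> = 4 * (64::real) ^ n"
    by (simp add: power2_eq_square power_mult_distrib[symmetric])
  finally have "1 / (4 * 64 ^ n) \<le> 1 / (real (Suc (block_start n + q)))\<^sup>2"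
    by (intro divide_left_mono) auto
  with deep have d: "1 / (4 * 64 ^ n)
      \<le> norm (ell1_nth x (block_start n + q)) / weight (block_start n + q)"
    by linarith
  have "real n \<le> 8 ^ n"
    using less_8_power[of n n] of_nat_le_iff[of n "8 ^ n", where 'a = real] by simp
  also have "(4::real) * 8 ^ n \<le> 8 ^ n * 8 ^ n"
    using n(1) power_increasing[of 1 n "8::real"] by (intro mult_right_mono) auto
  finally have n_le: "real n \<le> 64 ^ n / 4"
    by (simp flip: power_mult_distrib)
  have "(64::real) ^ n * 64 ^ n \<le> (16 ^ n) ^ n"
  proof -
    have "(64::real) * 64 \<le> 16 ^ n"
      using power_increasing[of 3 n "16::real"] n(1) by simp
    then have "(64 * 64 :: real) ^ n \<le> (16 ^ n) ^ n"
      by (rule power_mono) simp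
    then show ?thesis
      by (simp only: power_mult_distrib)
  qed
  also have "(16 ^ n) ^ n = ?W"
    by (simp add: power2_eq_square power_mult)
  finally have "64 ^ n / 4 \<le> ?W * (1 / (4 * 64 ^ n))"
    by (simp add: field_simps)
  moreover have "?W * (norm x / ?W') \<le> norm x"
  proof -
    have "?W \<le> ?W'"
      by (intro power_increasing power_mono) auto
    then show ?thesis
      using mult_left_mono[of ?W ?W' "norm x"] by (simp add: divide_le_eq mult.commute)
  qed
  moreover have "?W * (1 / (4 * 64 ^ n))
      \<le> ?W * (norm (ell1_nth x (block_start n + q)) / weight (block_start n + q))"
    using d by (intro mult_left_mono) auto
  ultimately have "1 \<le> ?W * (norm (ell1_nth x (block_start n + q)) / weight (block_start n + q)
      - norm x / ?W')"
    using n_le n(2) unfolding right_diff_distrib by linarith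
  also have "\<dots> \<le> norm ((T ^^ j) x)"
    using norm_funpow_ge[of q j n x] weight_high[of "q + j" n] j by (simp add: add.assoc)
  finally show ?thesis .
qed

text \<open>A frequently hypercyclic vector would have an orbit with unbounded first coordinate. By the previous
  two lemmas there are then arbitrarily large \<open>n\<close> such that the orbit is outside the unit ball at all
  times between \<open>ramp_length n\<close> and \<open>8 ^ n - n\<close>. Since \<open>ramp_length n\<close> is quadratic in \<open>n\<close>, the
  visits to the unit ball have lower density \<open>0\<close>.\<close>

theorem not_frequently_hypercyclic: "\<not> frequently_hypercyclic T"
proof
  assume "frequently_hypercyclic T"
  then obtain x where x: "\<And>U. open U \<Longrightarrow> U \<noteq> {} \<Longrightarrow> lower_density (return_times T x U) > 0"
    unfolding frequently_hypercyclic_def by blast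
  have "\<exists>j. norm (ell1_nth ((T ^^ j) x) 0) > M" for M
  proof -
    let ?U = "{y. norm (ell1_nth y 0) > M}"
    have "open ?U"
      by (intro open_Collect_less continuous_intros
          bounded_linear.continuous_on[OF bounded_linear_ell1_nth])
    moreover have "scaleC_ell1 (of_real (\<bar>M\<bar> + 1)) (unit_ell1 0) \<in> ?U"
      by (simp del: of_real_add)
    ultimately have "return_times T x ?U \<noteq> {}"
      using x lower_density_empty by (metis empty_iff)
    then show ?thesis
      by (auto simp: return_times_def)
  qed
  note deep = unbounded_imp_deep_mass[OF this]
  obtain c where c: "c > 0" and
    "\<forall>\<^sub>F N in sequentially. c < real (card ({0..N} \<inter> return_times T x (ball 0 1))) / real (N + 1)"
    using lower_density_pos_imp_eventually[OF x[of "ball 0 1"]] by auto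
  then obtain N0 where N0: "\<And>N. N \<ge> N0 \<Longrightarrow>
      c < real (card ({0..N} \<inter> return_times T x (ball 0 1))) / real (N + 1)"
    by (auto simp: eventually_sequentially)
  obtain S0 where S0: "1 / (real S0 + 1) < c"
    using reals_Archimedean[OF c] by (auto simp: inverse_eq_divide add.commute)
  obtain K :: nat where "norm x + 1 \<le> real K"
    using real_arch_simple by blast
  define S where "S = max 3 (max N0 (max S0 K))"
  obtain n q where n: "n \<ge> S" and q: "q < n" and dq: "1 / (real (Suc (block_start n + q)))\<^sup>2
      \<le> norm (ell1_nth x (block_start n + q)) / weight (block_start n + q)"
    using deep[of S] by blast
  have "n \<ge> 3" "n \<ge> N0" "n \<ge> S0" "real n \<ge> norm x + 1"
    using n \<open>norm x + 1 \<le> real K\<close> by (auto simp: S_def)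
  define N where "N = 8 ^ n - n - 1"
  have "n < 8 ^ n"
    by (simp add: less_8_power)
  then have N1: "N + 1 = 8 ^ n - n" and "N + 1 + n = 8 ^ n"
    by (auto simp: N_def)
  then have ramp: "ramp_length n * (n + 1) \<le> N + 1"
    using ramp_length_bound[OF \<open>n \<ge> 3\<close>] by linarith
  have "1 * (n + 1) \<le> ramp_length n * (n + 1)"
    using \<open>n \<ge> 3\<close> by (intro mult_le_mono1) (simp add: ramp_length_def)
  from le_trans[OF this ramp] \<open>n \<ge> N0\<close> have "N \<ge> N0"
    by simp
  have "{0..N} \<inter> return_times T x (ball 0 1) \<subseteq> {..<ramp_length n}"
  proof
    fix j assume "j \<in> {0..N} \<inter> return_times T x (ball 0 1)"
    then have j: "j \<le> N" "norm ((T ^^ j) x) < 1"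
      by (auto simp: return_times_def)
    have "q + j < 8 ^ n"
      using j q \<open>N + 1 + n = 8 ^ n\<close> by linarith
    then have "\<not> ramp_length n \<le> q + j"
      using deep_mass_imp_large_orbit[OF _ _ q dq] \<open>n \<ge> 3\<close> \<open>real n \<ge> norm x + 1\<close> j(2) by force
    then show "j \<in> {..<ramp_length n}"
      by simp
  qed
  from card_mono[OF _ this] have "card ({0..N} \<inter> return_times T x (ball 0 1)) \<le> ramp_length n"
    by simp
  then have "card ({0..N} \<inter> return_times T x (ball 0 1)) * (n + 1) \<le> N + 1"
    using ramp by (meson le_trans mult_le_mono1)
  then have "real (card ({0..N} \<inter> return_times T x (ball 0 1)) * (n + 1)) \<le> real (N + 1)"
    by (simp only: of_nat_le_iff)
  then have "real (card ({0..N} \<inter> return_times T x (ball 0 1))) / real (N + 1) \<le> 1 / (real n + 1)"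
    by (simp add: field_simps)
  also have "\<dots> \<le> 1 / (real S0 + 1)"
    using \<open>n \<ge> S0\<close> by (simp add: frac_le)
  finally show False
    using N0[OF \<open>N \<ge> N0\<close>] S0 by linarith
qed

end

section \<open>Existence of block operators with dense targets\<close>

lemma countable_dense_finitely_supported:
  obtains D :: "ell1 set" where "countable D" "closure D = UNIV"
    "\<And>y. y \<in> D \<Longrightarrow> \<exists>m. below_block m y"
proof -
  obtain Q :: "complex set" where Q: "countable Q"
    and dense: "\<And>X. open X \<Longrightarrow> X \<noteq> {} \<Longrightarrow> \<exists>d\<in>Q. d \<in> X"
    using countable_dense_exists by metis
  define vec where "vec zs = (\<Sum>k<length zs. scaleC_ell1 (zs ! k) (unit_ell1 k))" for zs
  show ?thesis
  proof (rule that[of "vec ` lists Q"])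
    show "countable (vec ` lists Q)"
      using Q by (intro countable_image countable_lists)
    show "\<exists>m. below_block m y" if y: "y \<in> vec ` lists Q" for y
    proof -
      obtain zs where "y = vec zs"
        using y by blast
      have "below_block (length zs) (unit_ell1 k)" if "k < length zs" for k
        using that le_block_start[of "length zs"] by (auto simp: below_block_def)
      then have "below_block (length zs) y"
        unfolding \<open>y = vec zs\<close> vec_def by (intro below_block_sum below_block_scaleC) auto
      then show ?thesis ..
    qed
    have "x \<in> closure (vec ` lists Q)" for x
      unfolding closure_approachable
    proof (intro allI impI)
      fix e :: real assume "e > 0"
      define P where "P N = (\<Sum>k<N. scaleC_ell1 (ell1_nth x k) (unit_ell1 k))" for N
      have "P \<longlonglongrightarrow> x"
        using ell1_expansion[of x] unfolding sums_def P_def[abs_def] .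
      then obtain N where N: "dist (P N) x < e / 2"
        using \<open>e > 0\<close> by (metis half_gt_zero lim_sequentially order_refl)
      define d where "d = e / (2 * real (N + 1))"
      have "d > 0"
        using \<open>e > 0\<close> by (simp add: d_def)
      have "\<exists>z\<in>Q. z \<in> ball (ell1_nth x k) d" for k
        using dense[of "ball (ell1_nth x k) d"] \<open>d > 0\<close> by simp
      then obtain z where z: "\<And>k. z k \<in> Q" "\<And>k. z k \<in> ball (ell1_nth x k) d"
        by metis
      define y where "y = vec (map z [0..<N])"
      have "y - P N = (\<Sum>k<N. scaleC_ell1 (z k - ell1_nth x k) (unit_ell1 k))"
        by (simp add: y_def vec_def P_def sum_subtractf[symmetric] ell1.scale_left_diff_distrib)
      then have "norm (y - P N) \<le> (\<Sum>k<N. norm (z k - ell1_nth x k))"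
        using norm_sum[of "\<lambda>k. scaleC_ell1 (z k - ell1_nth x k) (unit_ell1 k)" "{..<N}"]
        by (simp add: norm_scaleC_ell1)
      also have "\<dots> \<le> (\<Sum>k<N. d)"
        using z(2) by (intro sum_mono) (auto simp: dist_norm norm_minus_commute intro: less_imp_le)
      also have "\<dots> \<le> e / 2"
        using \<open>e > 0\<close> by (simp add: d_def field_simps)
      finally have "dist y (P N) \<le> e / 2"
        by (simp add: dist_norm)
      then have "dist y x < e"
        using N dist_triangle[of y x "P N"] by linarith
      moreover have "y \<in> vec ` lists Q"
        unfolding y_def using z(1) by (intro imageI) auto
      ultimately show "\<exists>y\<in>vec ` lists Q. dist y x < e" by blast
    qed
    then show "closure (vec ` lists Q) = UNIV" by blast
  qed
qed

text \<open>A code assigns to each \<open>n\<close> a multiple \<open>y / (c + 1)\<close> of a vector \<open>y\<close> from a dense sequence of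
  finitely supported vectors and a value of \<open>lam n\<close>, each combination infinitely often; \<open>v n\<close> is this
  multiple if it is admissible. The factor \<open>c\<close> must not depend on \<open>n\<close>. If \<open>c\<close> is at least twice
  the mass of \<open>y\<close>, then the multiple is admissible for all large \<open>n\<close> with this code.\<close>

lemma exhausting_targets:
  obtains v :: "nat \<Rightarrow> ell1" and lam :: "nat \<Rightarrow> complex"
  where "\<And>n. lam n = 0 \<or> lam n = 1" "\<And>n. below_block n (v n)" "\<And>n. mass_below n (v n) \<le> 1 / 2"
    "\<And>w e l. e > 0 \<Longrightarrow> l = 0 \<or> l = 1 \<Longrightarrow>
       \<exists>c>0. \<forall>S. \<exists>n\<ge>S. lam n = l \<and> norm (w - c *\<^sub>R v n) < e"
proof -
  obtain D :: "ell1 set" where D: "countable D" "closure D = UNIV"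
    and fin: "\<And>y. y \<in> D \<Longrightarrow> \<exists>m. below_block m y"
    using countable_dense_finitely_supported by metis
  have "D \<noteq> {}"
    using D(2) by auto
  define d where "d = from_nat_into D"
  \<comment> \<open>the fourth component of the code is ignored, which makes every triple occur infinitely often\<close>
  define code where "code n = (case prod_decode n of (i, r) \<Rightarrow>
      case prod_decode r of (c, s) \<Rightarrow> (i, c, fst (prod_decode s)))" for n
  define u where "u n = (case code n of (i, c, l) \<Rightarrow> (1 / real (Suc c)) *\<^sub>R d i)" for n
  define v where "v n = (if below_block n (u n) \<and> mass_below n (u n) \<le> 1 / 2 then u n else 0)" for n
  define lam :: "nat \<Rightarrow> complex" where
    "lam n = (case code n of (i, c, l) \<Rightarrow> if l = 0 then 0 else 1)" for n
  show ?thesis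
  proof (rule that[of lam v])
    show "lam n = 0 \<or> lam n = 1" for n
      by (simp add: lam_def split: prod.split)
    show "below_block n (v n)" "mass_below n (v n) \<le> 1 / 2" for n
      by (auto simp: v_def mass_below_def) (auto simp: below_block_def)
    fix w :: ell1 and e :: real and l :: complex
    assume e: "e > 0" and l: "l = 0 \<or> l = 1"
    have "w \<in> closure D"
      using D by simp
    then obtain y where y: "y \<in> D" "dist y w < e"
      using e closure_approachable by metis
    obtain i where i: "d i = y"
      using from_nat_into_surj[OF D(1) y(1)] unfolding d_def by blast
    obtain m where m: "below_block m y"
      using fin y by blast
    obtain c :: nat where c: "2 * mass_below m y \<le> real c"
      using real_arch_simple by blast
    have "\<exists>n\<ge>S. lam n = l \<and> norm (w - real (Suc c) *\<^sub>R v n) < e" for S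
    proof -
      define n where
        "n = prod_encode (i, prod_encode (c, prod_encode (if l = 0 then 0 else 1, max m S)))"
      have code: "code n = (i, c, if l = 0 then 0 else 1)"
        by (simp add: code_def n_def)
      have "max m S \<le> n"
        unfolding n_def by (meson le_prod_encode_2 le_trans)
      then have "m \<le> n" "S \<le> n" by auto
      have u: "u n = (1 / real (Suc c)) *\<^sub>R y"
        by (simp add: u_def code i)
      have "below_block n (u n)"
        using below_block_mono[OF m \<open>m \<le> n\<close>] by (simp add: u below_block_def)
      moreover have "mass_below n (u n) \<le> 1 / 2"
        using c unfolding u mass_below_scaleR mass_below_eq[OF m \<open>m \<le> n\<close>]
        by (simp add: field_simps)
      ultimately have "real (Suc c) *\<^sub>R v n = y"
        by (simp add: v_def) (simp add: u)
      moreover have "lam n = l"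
        using l by (auto simp: lam_def code)
      ultimately show ?thesis
        using y(2) \<open>S \<le> n\<close> by (auto simp: dist_norm norm_minus_commute)
    qed
    then show "\<exists>c>0. \<forall>S. \<exists>n\<ge>S. lam n = l \<and> norm (w - c *\<^sub>R v n) < e"
      by (intro exI[of _ "real (Suc c)"]) auto
  qed
qed

text \<open>Up to the rescaling between unit vectors and the vectors \<open>basis_vec k\<close>, this is the shift inside each
  block, closed up to a cycle if \<open>lam n = 1\<close>, plus the emission of \<open>G n\<close> into the earlier blocks at
  the end of block \<open>n\<close>.\<close>

definition block_column :: "(nat \<Rightarrow> complex) \<Rightarrow> (nat \<Rightarrow> ell1) \<Rightarrow> nat \<Rightarrow> ell1" where
  "block_column lam G k = (let n = block_of k in
     if Suc k < block_start (Suc n)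
     then scaleC_ell1 (of_real (weight (Suc k) / weight k)) (unit_ell1 (Suc k))
     else scaleC_ell1 (of_real (1 / weight k)) (scaleC_ell1 (lam n) (basis_vec (block_start n)) + G n))"

lemma norm_block_column_le:
  assumes "lam (block_of k) = 0 \<or> lam (block_of k) = 1"
  shows "norm (block_column lam G k) \<le> 2 + norm (G (block_of k)) / 16 ^ (block_of k)\<^sup>2"
proof -
  obtain n q where nq: "k = block_start n + q" "q < 8 ^ n"
    by (rule block_cases)
  then have bk: "block_of k = n"
    by (simp add: block_of_eq)
  show ?thesis
  proof (cases "Suc q < 8 ^ n")
    case True
    then have "weight (Suc k) / weight k \<le> 2"
      using weight_Suc_le[OF True] nq by (simp add: divide_le_eq)
    then have "norm (block_column lam G k) \<le> 2"
      using True nq bk by (simp add: block_column_def norm_scaleC_ell1 del: of_real_divide)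
    moreover have "0 \<le> norm (G n) / 16 ^ n\<^sup>2"
      by simp
    ultimately show ?thesis
      unfolding bk by linarith
  next
    case False
    then have w: "weight k = 16 ^ n\<^sup>2"
      using nq ramp_length_less[of n] by (simp add: weight_high)
    have "norm (scaleC_ell1 (lam n) (basis_vec (block_start n))) \<le> 16 ^ n\<^sup>2"
      using assms weight_le[of 0 n] bk by (auto simp: norm_scaleC_ell1 norm_basis_vec)
    then have "norm (scaleC_ell1 (lam n) (basis_vec (block_start n)) + G n) \<le> 16 ^ n\<^sup>2 + norm (G n)"
      by (meson add_mono norm_triangle_le order_refl)
    then have "norm (block_column lam G k) \<le> (16 ^ n\<^sup>2 + norm (G n)) / 16 ^ n\<^sup>2"
      using False nq bk w
      by (simp add: block_column_def norm_scaleC_ell1 norm_divide norm_power divide_right_mono)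
    also have "\<dots> \<le> 2 + norm (G n) / 16 ^ n\<^sup>2"
      by (simp add: add_divide_distrib)
    finally show ?thesis
      unfolding bk .
  qed
qed

text \<open>The emitted vector \<open>G n\<close> is the one for which the images of \<open>v n\<close> and of
  \<open>basis_vec (block_start n)\<close> after one lap differ by \<open>lam n\<close> times the original difference.\<close>

lemma block_operator_column_operator:
  fixes G v :: "nat \<Rightarrow> ell1" and lam :: "nat \<Rightarrow> complex"
  defines "T \<equiv> column_operator (block_column lam G)"
  assumes C: "\<And>k. norm (block_column lam G k) \<le> C"
    and lam: "\<And>n. lam n = 0 \<or> lam n = 1"
    and v: "\<And>n. below_block n (v n)" "\<And>n. mass_below n (v n) \<le> 1 / 2"
    and G: "\<And>n. G n = (T ^^ (8 ^ n)) (v n) - scaleC_ell1 (lam n) (v n)"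
  shows "block_operator T v lam"
proof -
  have bl: "bounded_linear T"
    unfolding T_def by (rule bounded_linear_column_operator[OF C])
  have scale: "T (scaleC_ell1 c x) = scaleC_ell1 c (T x)" for c x
    unfolding T_def by (rule column_operator_scaleC[OF C])
  have T_basis: "T (basis_vec k) = scaleC_ell1 (of_real (weight k)) (block_column lam G k)" for k
    unfolding basis_vec_def scale by (simp add: T_def column_operator_unit)
  have step: "T (basis_vec (block_start n + q)) = basis_vec (block_start n + Suc q)"
    if "Suc q < 8 ^ n" for n q
    using that unfolding T_basis
    by (simp add: block_column_def block_of_eq basis_vec_def)
  have iter: "(T ^^ q) (basis_vec (block_start n)) = basis_vec (block_start n + q)"
    if "q < 8 ^ n" for n q
    using that by (induction q) (simp_all add: step del: add_Suc_right)
  have wrap: "(T ^^ (8 ^ n)) (basis_vec (block_start n) - v n)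
      = scaleC_ell1 (lam n) (basis_vec (block_start n) - v n)" for n
  proof -
    obtain q where q: "8 ^ n = Suc q"
      using not0_implies_Suc[of "8 ^ n"] by auto
    then have "(T ^^ (8 ^ n)) (basis_vec (block_start n)) = T (basis_vec (block_start n + q))"
      using iter[of q n] by simp
    also have "\<dots> = scaleC_ell1 (lam n) (basis_vec (block_start n)) + G n"
      unfolding T_basis using q by (simp add: block_column_def block_of_eq)
    finally have F: "(T ^^ (8 ^ n)) (basis_vec (block_start n)) = \<dots>" .
    have "linear (T ^^ (8 ^ n))"
      by (rule linear_iterate[OF bounded_linear.linear[OF bl]])
    then show ?thesis
      by (simp add: linear_diff F G ell1.scale_right_diff_distrib)
  qed
  show ?thesis
    by (rule block_operator.intro[OF bl scale step wrap lam v(1) v(2)])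
qed

definition truncate :: "nat \<Rightarrow> (nat \<Rightarrow> ell1) \<Rightarrow> nat \<Rightarrow> ell1" where
  "truncate n G m = (if m < n then G m else 0)"

lemma norm_below_block: "below_block n y \<Longrightarrow> norm y = (\<Sum>k<block_start n. norm (ell1_nth y k))"
  unfolding norm_ell1_eq by (rule suminf_finite) (auto simp: below_block_def)

text \<open>The condition on \<open>G n\<close> involves the orbit of \<open>v n\<close>, hence only the columns in blocks before \<open>n\<close> and
  the values \<open>G m\<close> with \<open>m < n\<close>: it is a recursion. The truncations of \<open>G\<close> have trivially bounded
  columns, so they already yield block operators, for which all coefficients of orbits are
  controlled. This bounds \<open>G n\<close> by \<open>16 ^ n\<^sup>2\<close>, the weight at the end of block \<open>n\<close>, and so the full
  operator is bounded as well.\<close>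

lemma exists_block_operator:
  fixes v :: "nat \<Rightarrow> ell1" and lam :: "nat \<Rightarrow> complex"
  assumes lam: "\<And>n. lam n = 0 \<or> lam n = 1"
    and v: "\<And>n. below_block n (v n)" "\<And>n. mass_below n (v n) \<le> 1 / 2"
  shows "\<exists>T. block_operator T v lam"
proof -
  define op where "op G = column_operator (block_column lam G)" for G
  define next_image where "next_image G n =
      (op (truncate n G) ^^ (8 ^ n)) (v n) - scaleC_ell1 (lam n) (v n)" for G n
  have "\<exists>G. \<forall>n. G n = next_image G n"
  proof (rule dependent_wf_choice[where R = less_than and P = "\<lambda>G n r. r = next_image G n"])
    fix f g :: "nat \<Rightarrow> ell1" and n r
    assume "\<And>m. (m, n) \<in> less_than \<Longrightarrow> f m = g m"
    then have "truncate n f = truncate n g"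
      by (auto simp: truncate_def)
    then show "(r = next_image f n) = (r = next_image g n)"
      by (simp add: next_image_def)
  qed auto
  then obtain G where G: "\<And>n. G n = next_image G n"
    by blast
  have agree: "(op H ^^ j) (v m) = (op (truncate m G) ^^ j) (v m)"
    if loc: "block_operator (op (truncate m G)) (truncate m v) lam" and H: "\<And>l. l < m \<Longrightarrow> H l = G l"
    for H m j
  proof (induction j)
    case (Suc j)
    let ?y = "(op (truncate m G) ^^ j) (v m)"
    have y: "below_block m ?y"
      by (rule block_operator.below_block_funpow[OF loc v(1)])
    have "column_operator (block_column lam H) ?y
        = column_operator (block_column lam (truncate m G)) ?y"
    proof (rule column_operator_cong)
      fix k assume "ell1_nth ?y k \<noteq> 0"
      then have "k < block_start m"
        using y by (auto simp: below_block_def not_le[symmetric])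
      moreover obtain n q where "k = block_start n + q" "q < 8 ^ n"
        by (rule block_cases)
      ultimately have "block_of k < m"
        using block_start_less_imp by (simp add: block_of_eq)
      then show "block_column lam H k = block_column lam (truncate m G) k"
        by (simp add: block_column_def truncate_def H Let_def)
    qed
    then show ?case
      using Suc by (simp add: op_def)
  qed simp
  have trunc: "block_operator (op (truncate n G)) (truncate n v) lam" for n
  proof (induction n rule: less_induct)
    case (less n)
    define C where "C = 2 + (\<Sum>m<n. norm (G m))"
    show ?case
      unfolding op_def
    proof (rule block_operator_column_operator)
      fix k
      let ?m = "block_of k"
      have "norm (truncate n G ?m) / 16 ^ ?m\<^sup>2 \<le> norm (truncate n G ?m) / 1"
        by (intro divide_left_mono) auto
      also have "\<dots> \<le> (\<Sum>m<n. norm (G m))"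
        by (auto simp: truncate_def intro: member_le_sum sum_nonneg)
      finally show "norm (block_column lam (truncate n G) k) \<le> C"
        unfolding C_def using norm_block_column_le[of lam k "truncate n G", OF lam] by linarith
    next
      fix m
      show "below_block m (truncate n v m)" "mass_below m (truncate n v m) \<le> 1 / 2"
        using v by (auto simp: truncate_def below_block_def mass_below_def)
      have zero: "(op H ^^ j) 0 = 0" for H j
        by (induction j) (simp_all add: op_def column_operator_def)
      show "truncate n G m = (column_operator (block_column lam (truncate n G)) ^^ 8 ^ m) (truncate n v m)
          - scaleC_ell1 (lam m) (truncate n v m)"
        unfolding op_def[symmetric]
      proof (cases "m < n")
        case True
        then have "(op (truncate n G) ^^ 8 ^ m) (v m) = (op (truncate m G) ^^ 8 ^ m) (v m)"
          by (intro agree less.IH) (auto simp: truncate_def)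
        then show "truncate n G m = (op (truncate n G) ^^ 8 ^ m) (truncate n v m)
            - scaleC_ell1 (lam m) (truncate n v m)"
          using True G[of m] by (simp add: truncate_def[of n] next_image_def)
      next
        case False
        then show "truncate n G m = (op (truncate n G) ^^ 8 ^ m) (truncate n v m)
            - scaleC_ell1 (lam m) (truncate n v m)"
          by (simp add: truncate_def[of n] zero)
      qed
    qed (rule lam)
  qed
  have norm_G: "norm (G n) \<le> 16 ^ n\<^sup>2" for n
  proof -
    interpret block_operator "op (truncate n G)" "truncate n v" lam
      by (rule trunc)
    have G_eq: "G n = (op (truncate n G) ^^ (8 ^ n)) (v n) - scaleC_ell1 (lam n) (v n)"
      using G[of n] by (simp add: next_image_def)
    have "below_block n (G n)"
      unfolding G_eq by (intro below_block_diff below_block_scaleC below_block_funpow v)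
    have "norm (ell1_nth (G n) i) \<le> weight i" for i
    proof -
      have *: "norm (ell1_nth ((op (truncate n G) ^^ r) (v n)) i) \<le> weight i / 2" for r
        using coordinate_le_mass[OF v(1)[of n], of r i]
          mult_left_mono[OF v(2)[of n] weight_nonneg[of i]]
        by linarith
      have "norm (lam n * ell1_nth (v n) i) \<le> weight i / 2"
        using *[of 0] lam[of n] by auto
      moreover have "norm (ell1_nth (G n) i)
          \<le> norm (ell1_nth ((op (truncate n G) ^^ (8 ^ n)) (v n)) i) + norm (lam n * ell1_nth (v n) i)"
        unfolding G_eq by (simp add: norm_triangle_ineq4)
      ultimately show ?thesis
        using *[of "8 ^ n"] by linarith
    qed
    then have "norm (G n) \<le> (\<Sum>k<block_start n. weight k)"
      unfolding norm_below_block[OF \<open>below_block n (G n)\<close>] by (rule sum_mono)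
    then show ?thesis
      using sum_weight_le[of n] by linarith
  qed
  have "block_operator (op G) v lam"
    unfolding op_def
  proof (rule block_operator_column_operator)
    fix k
    have "norm (G (block_of k)) / 16 ^ (block_of k)\<^sup>2 \<le> 1"
      using norm_G[of "block_of k"] by simp
    then show "norm (block_column lam G k) \<le> 3"
      using norm_block_column_le[of lam k G, OF lam] by linarith
  next
    fix n
    show "G n = (column_operator (block_column lam G) ^^ 8 ^ n) (v n) - scaleC_ell1 (lam n) (v n)"
      using G[of n] agree[OF trunc, of n G "8 ^ n"] by (simp add: next_image_def op_def)
  qed (use lam v in auto)
  then show ?thesis by blast
qed

text \<open>The vectors \<open>c *\<^sub>R (basis_vec (block_start n) - v n)\<close> are dense: \<open>- c *\<^sub>R v n\<close> approximates
  any prescribed vector for infinitely many \<open>n\<close>, and the remaining part has norm \<open>c / 2 ^ n\<close>.\<close>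

lemma (in block_operator) closure_wrapping_vectors:
  assumes "\<And>w e. e > 0 \<Longrightarrow> \<exists>c>0. \<forall>S. \<exists>n\<ge>S. lam n = l \<and> norm (w - c *\<^sub>R v n) < e"
  shows "closure {y. \<exists>n. (T ^^ (8 ^ n)) y = scaleC_ell1 l y} = UNIV"
proof -
  have "w \<in> closure {y. \<exists>n. (T ^^ (8 ^ n)) y = scaleC_ell1 l y}" for w
    unfolding closure_approachable
  proof (intro allI impI)
    fix e :: real assume "e > 0"
    then obtain c where c: "c > 0" and
      n: "\<And>S. \<exists>n\<ge>S. lam n = l \<and> norm (- w - c *\<^sub>R v n) < e / 2"
      using assms[of "e / 2" "- w"] by auto
    have "(\<lambda>n. c * (1 / 2) ^ n) \<longlonglongrightarrow> 0"
      by (intro tendsto_mult_right_zero LIMSEQ_power_zero) simp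
    then have "\<forall>\<^sub>F n in sequentially. c * (1 / 2) ^ n < e / 2"
      using \<open>e > 0\<close> by (intro order_tendstoD(2)) auto
    then obtain S where S: "\<And>n. n \<ge> S \<Longrightarrow> c * (1 / 2) ^ n < e / 2"
      by (auto simp: eventually_sequentially)
    obtain n where nS: "n \<ge> S" and l: "lam n = l" and d: "norm (- w - c *\<^sub>R v n) < e / 2"
      using n[of S] by blast
    let ?y = "c *\<^sub>R (basis_vec (block_start n) - v n)"
    have "weight (block_start n) = (1 / 2) ^ n"
      using weight_eq[of 0 n] by (simp add: power_one_over)
    then have "norm (c *\<^sub>R basis_vec (block_start n)) < e / 2"
      using S[OF nS] c by (simp add: norm_basis_vec)
    moreover have "?y - w = c *\<^sub>R basis_vec (block_start n) + (- w - c *\<^sub>R v n)"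
      by (simp add: scaleR_diff_right)
    then have "dist ?y w \<le> norm (c *\<^sub>R basis_vec (block_start n)) + norm (- w - c *\<^sub>R v n)"
      unfolding dist_norm by (metis norm_triangle_ineq)
    ultimately have "dist ?y w < e"
      using d by linarith
    moreover have "(T ^^ (8 ^ n)) ?y = scaleC_ell1 l ?y"
      unfolding scaleR_eq_scaleC scale_funpow wrap l by (simp add: mult.commute)
    ultimately show "\<exists>y\<in>{y. \<exists>n. (T ^^ (8 ^ n)) y = scaleC_ell1 l y}. dist y w < e"
      by blast
  qed
  then show ?thesis by blast
qed

section \<open>The operator\<close>

theorem theorem2p7:
  shows "\<exists>T :: ell1 \<Rightarrow> ell1.
           Vector_Spaces.linear scaleC_ell1 scaleC_ell1 T \<and> continuous_on UNIV T \<and>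
           (\<forall>a\<in>weight_seqs. U_frequently_hypercyclic_wrt a T) \<and>
           \<not> frequently_hypercyclic T"
proof -
  obtain v :: "nat \<Rightarrow> ell1" and lam :: "nat \<Rightarrow> complex"
    where lam: "\<And>n. lam n = 0 \<or> lam n = 1"
      and v: "\<And>n. below_block n (v n)" "\<And>n. mass_below n (v n) \<le> 1 / 2"
      and dense: "\<And>w e l. e > 0 \<Longrightarrow> l = 0 \<or> l = 1 \<Longrightarrow>
        \<exists>c>0. \<forall>S. \<exists>n\<ge>S. lam n = l \<and> norm (w - c *\<^sub>R v n) < e"
    using exhausting_targets by metis
  obtain T where "block_operator T v lam"
    using exists_block_operator[of lam v, OF lam v] by blast
  then interpret block_operator T v lam .
  obtain D :: "ell1 set" where D: "countable D" "closure D = UNIV"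
    using countable_dense_finitely_supported by metis
  have cont: "continuous_on UNIV T"
    using bounded linear_continuous_on by blast
  have lin: "Vector_Spaces.linear scaleC_ell1 scaleC_ell1 T"
    by unfold_locales (simp_all add: scale linear_add[OF bounded_linear.linear[OF bounded]])
  have "closure {y. \<exists>n. (T ^^ (8 ^ n)) y = scaleC_ell1 1 y} = UNIV"
    using dense by (intro closure_wrapping_vectors) auto
  moreover have "{y. \<exists>n. (T ^^ (8 ^ n)) y = scaleC_ell1 1 y} \<subseteq> {p. \<exists>R>0. (T ^^ R) p = p}"
  proof clarsimp
    fix p n assume "(T ^^ 8 ^ n) p = p"
    then show "\<exists>R>0. (T ^^ R) p = p"
      by (intro exI[of _ "8 ^ n"]) simp
  qed
  ultimately have per: "closure {p. \<exists>R>0. (T ^^ R) p = p} = UNIV"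
    using closure_mono by blast
  have "closure {y. \<exists>n. (T ^^ (8 ^ n)) y = scaleC_ell1 0 y} = UNIV"
    using dense by (intro closure_wrapping_vectors) auto
  moreover have "{y. \<exists>n. (T ^^ (8 ^ n)) y = scaleC_ell1 0 y} \<subseteq> {y. \<exists>m. (T ^^ m) y = 0}"
    by auto
  ultimately have nil: "closure {y. \<exists>m. (T ^^ m) y = 0} = UNIV"
    using closure_mono by blast
  have "U_frequently_hypercyclic_wrt a T" if "a \<in> weight_seqs" for a
    by (rule U_frequently_hypercyclic_wrt_if_dense_periodic_dense_nilpotent
        [OF cont bounded_linear.linear[OF bounded] D per nil that])
  then show ?thesis
    using cont lin not_frequently_hypercyclic by blast
qed

end
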